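(* Every semiprimitive permutation group that has a plinth is permutationally isomorphic to $\mathcal G(K,H,L)$ acting on $\Omega(K,H,L)$ for some semiprimitive triple $(K,H,L)$; and conversely, for every semiprimitive triple $(K,H,L)$, the group $\mathcal G(K,H,L)$ acting on $\Omega(K,H,L)$ is semiprimitive.
   Context: Groups and sets may be infinite. A permutation group is semiregular if all its point-stabilisers are trivial. A transitive permutation group $G$ is semiprimitive if every normal subgroup of $G$ is transitive or semiregular. A plinth of $G$ is a transitive normal subgroup $K$ of $G$ such that no proper subgroup of $K$ that is normal in $G$ is transitive. For a group $K$ and $x\in K$, $c_x$ denotes the automorphism of $K$ induced by conjugation by $x$, $k\mapsto x^{-1}kx$. Automorphisms act on the right, written as exponents. Semiprimitive triple: a triple $(K,H,L)$ such that (1) $K$ is a group and $H$ is a group of automorphisms of $K$ such that $H$ acts faithfully on each non-trivial $H$-invariant quotient of $K$; (2) $L$ is a normal subgroup of $K_0:=\{k\in K\mid c_k\in H\}$, $L$ is core-free in $K$, $L$ is normalised by $H$, and, if $L\neq 1$, then $K=[K,K]$; (3) $K\neq LR$ for any proper normal subgroup $R$ of $K$ that is $H$-invariant. Construction: given a semiprimitive triple $(K,H,L)$, let $X=K\rtimes H$ with elements written $(h,k)$, $h\in H$, $k\in K$, and multiplication $(h,k)(h',k')=(hh',k^{h'}k')$; identify $K,L,H$ with their images in $X$. Let $Y=HL$, let $\Omega(K,H,L)=[X:Y]$ be the set of right cosets of $Y$ in $X$, on which $X$ acts by right multiplication, let $Z=\{(c_{u^{-1}},u)\mid u\in L\}$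 (this is the kernel of the action of $X$ on $\Omega(K,H,L)$), and let $\mathcal G(K,H,L)=X/Z$. *)

theory Defs
  imports "HOL-Algebra.Algebra"
begin

section \<open>Permutation groups (acting on the right)\<close>

definition opposite_group :: "('g, 'm) monoid_scheme \<Rightarrow> ('g, 'm) monoid_scheme" where
  "opposite_group G = G\<lparr>monoid.mult := \<lambda>x y. y \<otimes>\<^bsub>G\<^esub> x\<rparr>"

text \<open>
  A permutation group is a group with a faithful right action: \<open>\<phi> g \<omega>\<close> is the image of the
  point \<open>\<omega>\<close> under \<open>g\<close>, and \<open>\<phi> (g \<otimes> g')\<close> is ``first \<open>\<phi> g\<close>, then \<open>\<phi> g'\<close>''. The library's
  group actions are left actions, and a right action of \<open>G\<close> is a left action of its opposite.
  The library constants \<^const>\<open>orbits\<close> and \<^const>\<open>stabilizer\<close> do not depend on the side.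
\<close>

definition permutation_group ::
  "('g, 'm) monoid_scheme \<Rightarrow> 'a set \<Rightarrow> ('g \<Rightarrow> 'a \<Rightarrow> 'a) \<Rightarrow> bool" where
  "permutation_group G \<Omega> \<phi> \<longleftrightarrow> group G \<and> faithful_action (opposite_group G) \<Omega> \<phi>"

text \<open>Having \<open>\<Omega>\<close> as its only orbit makes \<open>\<Omega>\<close> non-empty.\<close>

definition transitive_on ::
  "('g, 'm) monoid_scheme \<Rightarrow> 'a set \<Rightarrow> ('g \<Rightarrow> 'a \<Rightarrow> 'a) \<Rightarrow> 'g set \<Rightarrow> bool" where
  "transitive_on G \<Omega> \<phi> N \<longleftrightarrow> orbits (G\<lparr>carrier := N\<rparr>) \<Omega> \<phi> = {\<Omega>}"

definition semiregular_on ::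
  "('g, 'm) monoid_scheme \<Rightarrow> 'a set \<Rightarrow> ('g \<Rightarrow> 'a \<Rightarrow> 'a) \<Rightarrow> 'g set \<Rightarrow> bool" where
  "semiregular_on G \<Omega> \<phi> N \<longleftrightarrow> (\<forall>\<omega>\<in>\<Omega>. stabilizer (G\<lparr>carrier := N\<rparr>) \<phi> \<omega> = {\<one>\<^bsub>G\<^esub>})"

definition semiprimitive ::
  "('g, 'm) monoid_scheme \<Rightarrow> 'a set \<Rightarrow> ('g \<Rightarrow> 'a \<Rightarrow> 'a) \<Rightarrow> bool" where
  "semiprimitive G \<Omega> \<phi> \<longleftrightarrow>
     permutation_group G \<Omega> \<phi> \<and>
     transitive_on G \<Omega> \<phi> (carrier G) \<and>
     (\<forall>N. N \<lhd> G \<longrightarrow> transitive_on G \<Omega> \<phi> N \<or> semiregular_on G \<Omega> \<phi> N)"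

definition plinth ::
  "('g, 'm) monoid_scheme \<Rightarrow> 'a set \<Rightarrow> ('g \<Rightarrow> 'a \<Rightarrow> 'a) \<Rightarrow> 'g set \<Rightarrow> bool" where
  "plinth G \<Omega> \<phi> K \<longleftrightarrow>
     K \<lhd> G \<and> transitive_on G \<Omega> \<phi> K \<and>
     (\<forall>M. M \<lhd> G \<and> M \<subset> K \<longrightarrow> \<not> transitive_on G \<Omega> \<phi> M)"

definition permutationally_isomorphic ::
  "('g, 'm) monoid_scheme \<Rightarrow> 'a set \<Rightarrow> ('g \<Rightarrow> 'a \<Rightarrow> 'a) \<Rightarrow>
   ('h, 'n) monoid_scheme \<Rightarrow> 'b set \<Rightarrow> ('h \<Rightarrow> 'b \<Rightarrow> 'b) \<Rightarrow> bool" where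
  "permutationally_isomorphic G \<Omega> \<phi> G' \<Omega>' \<phi>' \<longleftrightarrow>
     (\<exists>\<theta> \<psi>. bij_betw \<theta> \<Omega> \<Omega>' \<and> \<psi> \<in> iso G G' \<and>
       (\<forall>g\<in>carrier G. \<forall>\<omega>\<in>\<Omega>. \<theta> (\<phi> g \<omega>) = \<phi>' (\<psi> g) (\<theta> \<omega>)))"

section \<open>Semiprimitive triples\<close>

definition conj_auto :: "('k, 'm) monoid_scheme \<Rightarrow> 'k \<Rightarrow> 'k \<Rightarrow> 'k" where
  "conj_auto K x = (\<lambda>k\<in>carrier K. inv\<^bsub>K\<^esub> x \<otimes>\<^bsub>K\<^esub> k \<otimes>\<^bsub>K\<^esub> x)"

definition invariant_under :: "('k \<Rightarrow> 'k) set \<Rightarrow> 'k set \<Rightarrow> bool" where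
  "invariant_under H R \<longleftrightarrow> (\<forall>h\<in>H. h ` R = R)"

text \<open>
  The image of the coset \<open>Rk\<close> under \<open>h\<close> is the coset \<open>h ` (Rk)\<close>. As \<^const>\<open>AutoGroup\<close> composes
  automorphisms from right to left, this is a left action of \<open>H \<le> AutoGroup K\<close>.
\<close>

definition faithful_on_quotient ::
  "('k, 'm) monoid_scheme \<Rightarrow> ('k \<Rightarrow> 'k) set \<Rightarrow> 'k set \<Rightarrow> bool" where
  "faithful_on_quotient K H R \<longleftrightarrow>
     faithful_action (AutoGroup K\<lparr>carrier := H\<rparr>) (carrier (K Mod R))
       (\<lambda>h. \<lambda>C\<in>carrier (K Mod R). h ` C)"

definition conj_preimage :: "('k, 'm) monoid_scheme \<Rightarrow> ('k \<Rightarrow> 'k) set \<Rightarrow> 'k set" where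
  "conj_preimage K H = {k \<in> carrier K. conj_auto K k \<in> H}"

definition core_free :: "('k, 'm) monoid_scheme \<Rightarrow> 'k set \<Rightarrow> bool" where
  "core_free K L \<longleftrightarrow> (\<Inter>k\<in>carrier K. inv\<^bsub>K\<^esub> k <#\<^bsub>K\<^esub> L #>\<^bsub>K\<^esub> k) = {\<one>\<^bsub>K\<^esub>}"

definition semiprimitive_triple ::
  "('k, 'm) monoid_scheme \<Rightarrow> ('k \<Rightarrow> 'k) set \<Rightarrow> 'k set \<Rightarrow> bool" where
  "semiprimitive_triple K H L \<longleftrightarrow>
     group K \<and> subgroup H (AutoGroup K) \<and>
     (\<forall>R. R \<lhd> K \<and> R \<noteq> carrier K \<and> invariant_under H R \<longrightarrow> faithful_on_quotient K H R) \<and>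
     L \<lhd> K\<lparr>carrier := conj_preimage K H\<rparr> \<and>
     core_free K L \<and>
     invariant_under H L \<and>
     (L \<noteq> {\<one>\<^bsub>K\<^esub>} \<longrightarrow> carrier K = derived K (carrier K)) \<and>
     (\<forall>R. R \<lhd> K \<and> R \<noteq> carrier K \<and> invariant_under H R \<longrightarrow> carrier K \<noteq> L <#>\<^bsub>K\<^esub> R)"

section \<open>The construction\<close>

text \<open>
  Automorphisms act on the right, so the product \<open>hh'\<close> in \<open>H\<close> applies \<open>h\<close> first, and
  \<open>k\<^bsup>h'\<^esup>\<close> is \<open>h' k\<close>.
\<close>

definition semidirect ::
  "('k, 'm) monoid_scheme \<Rightarrow> ('k \<Rightarrow> 'k) set \<Rightarrow> (('k \<Rightarrow> 'k) \<times> 'k) monoid" where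
  "semidirect K H =
     \<lparr>carrier = H \<times> carrier K,
      monoid.mult = (\<lambda>(h, k) (h', k'). (compose (carrier K) h' h, h' k \<otimes>\<^bsub>K\<^esub> k')),
      one = (\<lambda>k\<in>carrier K. k, \<one>\<^bsub>K\<^esub>)\<rparr>"

definition triple_stabilizer ::
  "('k, 'm) monoid_scheme \<Rightarrow> ('k \<Rightarrow> 'k) set \<Rightarrow> 'k set \<Rightarrow> (('k \<Rightarrow> 'k) \<times> 'k) set" where
  "triple_stabilizer K H L =
     (H \<times> {\<one>\<^bsub>K\<^esub>}) <#>\<^bsub>semidirect K H\<^esub> ({\<lambda>k\<in>carrier K. k} \<times> L)"

definition triple_points ::
  "('k, 'm) monoid_scheme \<Rightarrow> ('k \<Rightarrow> 'k) set \<Rightarrow> 'k set \<Rightarrow> (('k \<Rightarrow> 'k) \<times> 'k) set set" where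
  "triple_points K H L = rcosets\<^bsub>semidirect K H\<^esub> (triple_stabilizer K H L)"

definition triple_kernel :: "('k, 'm) monoid_scheme \<Rightarrow> 'k set \<Rightarrow> (('k \<Rightarrow> 'k) \<times> 'k) set" where
  "triple_kernel K L = {(conj_auto K (inv\<^bsub>K\<^esub> u), u) | u. u \<in> L}"

definition triple_group ::
  "('k, 'm) monoid_scheme \<Rightarrow> ('k \<Rightarrow> 'k) set \<Rightarrow> 'k set \<Rightarrow> (('k \<Rightarrow> 'k) \<times> 'k) set monoid" where
  "triple_group K H L = semidirect K H Mod triple_kernel K L"

text \<open>
  An element \<open>Zx\<close> of the quotient acts as the permutation \<open>Yg \<mapsto> Ygx\<close>, which is the same for all
  representatives \<open>x\<close> of \<open>Zx\<close>.
\<close>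

definition triple_action ::
  "('k, 'm) monoid_scheme \<Rightarrow> ('k \<Rightarrow> 'k) set \<Rightarrow> 'k set \<Rightarrow>
   (('k \<Rightarrow> 'k) \<times> 'k) set \<Rightarrow> (('k \<Rightarrow> 'k) \<times> 'k) set \<Rightarrow> (('k \<Rightarrow> 'k) \<times> 'k) set" where
  "triple_action K H L C =
     the_elem ((\<lambda>x. \<lambda>D\<in>triple_points K H L. D #>\<^bsub>semidirect K H\<^esub> x) ` C)"

end

theory Submission
  imports Defs
begin

text \<open>
  Let \<open>G\<close> be semiprimitive with plinth \<open>P\<close> and let \<open>\<alpha>\<close> be a point. Take \<open>K = P\<close>, let \<open>H\<close> be the group of
  automorphisms that the stabiliser \<open>G\<^sub>\<alpha>\<close> induces on \<open>P\<close> by conjugation, and \<open>L = P \<inter> G\<^sub>\<alpha>\<close>. Since \<open>P\<close> is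
  transitive, \<open>G = G\<^sub>\<alpha> P\<close> and \<open>H\<close> is isomorphic to \<open>G\<^sub>\<alpha>\<close>, so multiplication gives an epimorphism
  from the semidirect product \<open>X\<close> of \<open>K\<close> by \<open>H\<close> onto \<open>G\<close>; its kernel is \<open>Z\<close>, and the preimage of \<open>G\<^sub>\<alpha>\<close> is \<open>HL\<close>.
  The \<open>H\<close>-invariant normal subgroups of \<open>P\<close> are normal in \<open>G\<close>, so proper ones are intransitive, which yields the conditions on the triple;
  in particular \<open>L\<close> acts trivially on \<open>P/[P,P]\<close>, hence \<open>P\<close> is perfect unless \<open>L = 1\<close>.

  Conversely, let \<open>N\<close> be a normal subgroup of \<open>X\<close> containing \<open>Z\<close>, and let \<open>R = N \<inter> K\<close>. If \<open>R = K\<close> then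
  \<open>N\<close> is transitive. Otherwise \<open>N \<inter> H\<close> centralises \<open>K/R\<close>, hence is trivial, and \<open>N \<inter> HL = Z\<close> because
  \<open>HL = HZ\<close>.
\<close>

section \<open>Permutation groups\<close>

lemma (in group) mult_inv_cancel:
  assumes "x \<in> carrier G" "y \<in> carrier G"
  shows "x \<otimes> (inv x \<otimes> y) = y" "inv x \<otimes> (x \<otimes> y) = y"
  using assms by (simp_all flip: m_assoc)

lemma group_opposite_group:
  fixes G (structure)
  assumes "group G"
  shows "group (opposite_group G)"
proof -
  interpret group G by fact
  show ?thesis
  proof (rule groupI)
    fix x assume "x \<in> carrier (opposite_group G)"
    then show "\<exists>y\<in>carrier (opposite_group G). y \<otimes>\<^bsub>opposite_group G\<^esub> x = \<one>\<^bsub>opposite_group G\<^esub>"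
      by (auto simp: opposite_group_def intro: bexI[of _ "inv x"])
  qed (simp_all add: opposite_group_def m_assoc)
qed

text \<open>The action of \<open>inv g\<close> undoes that of \<open>g\<close>, so the pointwise
  laws already make \<open>\<phi> g\<close> a bijection, and injectivity of \<open>\<phi>\<close> is
  triviality of its kernel. The extensionality premise is there because \<open>BijGroup E\<close>
  consists of extensional functions.\<close>

lemma faithful_actionI:
  fixes G (structure)
  assumes "group G"
    and ext: "\<And>g. g \<in> carrier G \<Longrightarrow> \<phi> g \<in> extensional E"
    and closed: "\<And>g e. g \<in> carrier G \<Longrightarrow> e \<in> E \<Longrightarrow> \<phi> g e \<in> E"
    and mult: "\<And>g h e. g \<in> carrier G \<Longrightarrow> h \<in> carrier G \<Longrightarrow> e \<in> E \<Longrightarrow> \<phi> (g \<otimes>\<^bsub>G\<^esub> h) e = \<phi> g (\<phi> h e)"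
    and one: "\<And>e. e \<in> E \<Longrightarrow> \<phi> \<one>\<^bsub>G\<^esub> e = e"
    and faithful: "\<And>g. g \<in> carrier G \<Longrightarrow> (\<And>e. e \<in> E \<Longrightarrow> \<phi> g e = e) \<Longrightarrow> g = \<one>\<^bsub>G\<^esub>"
  shows "faithful_action G E \<phi>"
proof -
  interpret group G by fact
  have Bij: "\<phi> g \<in> Bij E" if g: "g \<in> carrier G" for g
  proof -
    have "bij_betw (\<phi> g) E E"
    proof (rule bij_betw_byWitness[where f' = "\<phi> (inv g)"])
      show "\<forall>a\<in>E. \<phi> (inv g) (\<phi> g a) = a" "\<forall>a\<in>E. \<phi> g (\<phi> (inv g) a) = a"
        using g mult[of "inv g" g] mult[of g "inv g"] one by simp_all
    qed (use g closed in auto)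
    then show ?thesis using ext[OF g] by (simp add: Bij_def)
  qed
  have hom: "\<phi> \<in> hom G (BijGroup E)"
  proof (rule homI)
    fix g h assume gh: "g \<in> carrier G" "h \<in> carrier G"
    have "\<phi> (g \<otimes> h) = compose E (\<phi> g) (\<phi> h)"
    proof (rule extensionalityI[where A = E])
      show "\<phi> (g \<otimes> h) \<in> extensional E" using gh ext by simp
      show "compose E (\<phi> g) (\<phi> h) \<in> extensional E" by simp
      show "\<phi> (g \<otimes> h) e = compose E (\<phi> g) (\<phi> h) e" if "e \<in> E" for e
        using that mult[OF gh that] by (simp add: compose_eq)
    qed
    then show "\<phi> (g \<otimes> h) = \<phi> g \<otimes>\<^bsub>BijGroup E\<^esub> \<phi> h"
      using gh Bij by (simp add: BijGroup_def)
  qed (use Bij in \<open>simp add: BijGroup_def\<close>)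
  interpret h: group_hom G "BijGroup E" \<phi>
    using hom group_BijGroup by (simp add: group_hom_def group_hom_axioms_def is_group)
  show ?thesis
  proof
    show "inj_on \<phi> (carrier G)"
    proof (rule h.inj_on_one_iff[THEN iffD2], intro allI impI)
      fix g assume g: "g \<in> carrier G" "\<phi> g = \<one>\<^bsub>BijGroup E\<^esub>"
      show "g = \<one>"
        by (rule faithful[OF g(1)]) (use g in \<open>simp add: BijGroup_def\<close>)
    qed
  qed
qed

locale perm_group = group G for G (structure) +
  fixes \<Omega> \<phi>
  assumes permutation_group: "permutation_group G \<Omega> \<phi>"
begin

lemma opposite_action: "faithful_action (opposite_group G) \<Omega> \<phi>"
  using permutation_group by (simp add: permutation_group_def)

lemma act_closed: "g \<in> carrier G \<Longrightarrow> \<omega> \<in> \<Omega> \<Longrightarrow> \<phi> g \<omega> \<in> \<Omega>"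
  using group_action.element_image[OF faithful_action.axioms(1)[OF opposite_action], of g \<omega>]
  by (simp add: opposite_group_def)

lemma act_mult:
  "g \<in> carrier G \<Longrightarrow> h \<in> carrier G \<Longrightarrow> \<omega> \<in> \<Omega> \<Longrightarrow> \<phi> (g \<otimes> h) \<omega> = \<phi> h (\<phi> g \<omega>)"
  using group_action.composition_rule[OF faithful_action.axioms(1)[OF opposite_action], of \<omega> h g]
  by (simp add: opposite_group_def)

lemma act_one: "\<omega> \<in> \<Omega> \<Longrightarrow> \<phi> \<one> \<omega> = \<omega>"
  using group_action.id_eq_one[OF faithful_action.axioms(1)[OF opposite_action]]
  by (simp add: opposite_group_def fun_eq_iff restrict_def) metis

lemma act_faithful:
  assumes g: "g \<in> carrier G" and triv: "\<And>\<omega>. \<omega> \<in> \<Omega> \<Longrightarrow> \<phi> g \<omega> = \<omega>"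
  shows "g = \<one>"
proof -
  interpret a: faithful_action "opposite_group G" \<Omega> \<phi> by (rule opposite_action)
  have "\<phi> g \<in> extensional \<Omega>"
    using a.bij_prop0[of g] g by (simp add: opposite_group_def Bij_def)
  then have "\<phi> g = (\<lambda>\<omega>\<in>\<Omega>. \<omega>)"
    by (rule extensionalityI) (use triv in simp_all)
  also have "\<dots> = \<phi> \<one>"
    using a.id_eq_one by (simp add: opposite_group_def)
  finally show ?thesis
    using a.faithful g by (simp add: inj_on_def opposite_group_def)
qed

lemma act_inv:
  assumes "g \<in> carrier G" "\<omega> \<in> \<Omega>"
  shows "\<phi> (inv g) (\<phi> g \<omega>) = \<omega>" "\<phi> g (\<phi> (inv g) \<omega>) = \<omega>"
  using assms act_mult[of g "inv g" \<omega>] act_mult[of "inv g" g \<omega>] act_one by simp_all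

text \<open>An empty \<open>\<Omega>\<close> has no orbits at all, so its set of orbits is empty and
  differs from \<open>{\<Omega>}\<close>; this is the source of the non-emptiness conjunct.\<close>

lemma transitive_on_iff:
  assumes "N \<subseteq> carrier G"
  shows "transitive_on G \<Omega> \<phi> N \<longleftrightarrow> \<Omega> \<noteq> {} \<and> (\<forall>\<omega>\<in>\<Omega>. \<forall>\<omega>'\<in>\<Omega>. \<exists>g\<in>N. \<phi> g \<omega> = \<omega>')"
proof -
  have sub: "orbit (G\<lparr>carrier := N\<rparr>) \<phi> \<omega> \<subseteq> \<Omega>" if "\<omega> \<in> \<Omega>" for \<omega>
    using that assms act_closed by (auto simp: orbit_def)
  have "transitive_on G \<Omega> \<phi> N \<longleftrightarrow> \<Omega> \<noteq> {} \<and> (\<forall>\<omega>\<in>\<Omega>. orbit (G\<lparr>carrier := N\<rparr>) \<phi> \<omega> = \<Omega>)"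
    unfolding transitive_on_def orbits_def by blast
  also have "\<dots> \<longleftrightarrow> \<Omega> \<noteq> {} \<and> (\<forall>\<omega>\<in>\<Omega>. \<Omega> \<subseteq> orbit (G\<lparr>carrier := N\<rparr>) \<phi> \<omega>)"
    using sub by blast
  also have "\<dots> \<longleftrightarrow> \<Omega> \<noteq> {} \<and> (\<forall>\<omega>\<in>\<Omega>. \<forall>\<omega>'\<in>\<Omega>. \<exists>g\<in>N. \<phi> g \<omega> = \<omega>')"
  proof -
    have "\<Omega> \<subseteq> orbit (G\<lparr>carrier := N\<rparr>) \<phi> \<omega> \<longleftrightarrow> (\<forall>\<omega>'\<in>\<Omega>. \<exists>g\<in>N. \<phi> g \<omega> = \<omega>')" for \<omega>
      unfolding orbit_def by fastforce
    then show ?thesis by simp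
  qed
  finally show ?thesis .
qed

end

lemma semiregular_on_iff:
  "semiregular_on G \<Omega> \<phi> N \<longleftrightarrow> (\<forall>\<omega>\<in>\<Omega>. {g \<in> N. \<phi> g \<omega> = \<omega>} = {\<one>\<^bsub>G\<^esub>})"
  by (simp add: semiregular_on_def stabilizer_def)

section \<open>Actions on cosets\<close>

text \<open>This is \<open>triple_action\<close> with the semidirect product replaced by an
  arbitrary group \<open>U\<close>. The use of \<open>the_elem\<close> is meaningful only if all
  elements of \<open>C\<close> act alike, which \<open>coset_action_rcoset\<close> establishes for
  cosets of a normal subgroup contained in \<open>Y\<close>.\<close>

definition coset_action ::
  "('g, 'm) monoid_scheme \<Rightarrow> 'g set \<Rightarrow> 'g set \<Rightarrow> 'g set \<Rightarrow> 'g set" where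
  "coset_action U Y C = the_elem ((\<lambda>x. \<lambda>D\<in>rcosets\<^bsub>U\<^esub> Y. D #>\<^bsub>U\<^esub> x) ` C)"

locale coset_space = Y: subgroup Y U + Z: normal Z U for U (structure) and Y Z +
  assumes Z_subset: "Z \<subseteq> Y"
begin

lemma rcosetsE:
  assumes "D \<in> rcosets Y"
  obtains a where "a \<in> carrier U" "D = Y #> a"
  using assms by (auto simp: RCOSETS_def)

lemma FactGroupE:
  assumes "C \<in> carrier (U Mod Z)"
  obtains x where "x \<in> carrier U" "C = Z #> x"
  using assms by (auto simp: carrier_FactGroup)

lemma rcoset_eq_iff:
  assumes "a \<in> carrier U" "b \<in> carrier U"
  shows "Y #> a = Y #> b \<longleftrightarrow> a \<otimes> inv b \<in> Y"
proof
  assume "Y #> a = Y #> b"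
  then have "a \<in> Y #> b" using Z.rcos_self[OF assms(1) Y.subgroup_axioms] by simp
  then show "a \<otimes> inv b \<in> Y" using Y.rcos_module[OF Z.is_group assms(2,1)] by simp
next
  assume "a \<otimes> inv b \<in> Y"
  then have "a \<in> Y #> b" using Y.rcos_module[OF Z.is_group assms(2,1)] by simp
  then show "Y #> a = Y #> b" using Z.repr_independence[OF _ assms(2) Y.subgroup_axioms] by simp
qed

lemma rcoset_mult:
  assumes "a \<in> carrier U" "x \<in> carrier U"
  shows "Y #> a #> x = Y #> (a \<otimes> x)"
  using assms by (simp add: Z.coset_mult_assoc Y.subset)

text \<open>For \<open>u \<in> Z\<close> the conjugate \<open>a \<otimes> u \<otimes> inv a\<close>
  is in \<open>Z\<close>, hence in \<open>Y\<close>, so \<open>u \<otimes> x\<close> and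
  \<open>x\<close> send \<open>Y #> a\<close> to the same coset. Thus the image set under
  \<open>the_elem\<close> is a singleton.\<close>

lemma coset_action_rcoset:
  assumes x: "x \<in> carrier U"
  shows "coset_action U Y (Z #> x) = (\<lambda>D\<in>rcosets Y. D #> x)"
proof -
  have "(\<lambda>D\<in>rcosets Y. D #> z) = (\<lambda>D\<in>(rcosets Y). D #> x)" if z: "z \<in> Z #> x" for z
  proof (rule restrict_ext)
    fix D assume "D \<in> rcosets Y"
    then obtain a where a: "a \<in> carrier U" "D = Y #> a" by (rule rcosetsE)
    obtain u where u: "u \<in> Z" "z = u \<otimes> x" using z by (auto simp: r_coset_def)
    have uU: "u \<in> carrier U" using u by simp
    have "a \<otimes> u \<otimes> inv a \<in> Y"
      using Z.inv_op_closed2[OF a(1) u(1)] Z_subset by blast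
    then have "Y #> (a \<otimes> u \<otimes> x) = Y #> (a \<otimes> x)"
      using a uU x by (subst rcoset_eq_iff) (simp_all add: Z.m_assoc Z.inv_mult_group Z.mult_inv_cancel)
    then show "D #> z = D #> x"
      using a u uU x by (simp add: rcoset_mult Z.m_assoc)
  qed
  then have "(\<lambda>z. \<lambda>D\<in>rcosets Y. D #> z) ` (Z #> x) = {\<lambda>D\<in>(rcosets Y). D #> x}"
    using Z.rcos_self[OF x Z.subgroup_axioms] by blast
  then show ?thesis by (simp add: coset_action_def)
qed

lemma coset_action_eq:
  assumes "x \<in> carrier U" "a \<in> carrier U"
  shows "coset_action U Y (Z #> x) (Y #> a) = Y #> (a \<otimes> x)"
  using assms by (simp add: coset_action_rcoset rcoset_mult Z.rcosetsI Y.subset)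

end

text \<open>Being normal and inside \<open>Y\<close>, the subgroup \<open>Z\<close> lies in the core
  of \<open>Y\<close>. The assumption is the reverse inclusion, so \<open>Z\<close> is exactly the
  kernel of the action of \<open>U\<close> on the cosets of \<open>Y\<close>.\<close>

locale core_coset_space = coset_space +
  assumes core: "\<And>x. x \<in> carrier U \<Longrightarrow> (\<And>a. a \<in> carrier U \<Longrightarrow> a \<otimes> x \<otimes> inv a \<in> Y) \<Longrightarrow> x \<in> Z"
begin

lemma coset_fix_iff:
  assumes "x \<in> carrier U" "a \<in> carrier U"
  shows "coset_action U Y (Z #> x) (Y #> a) = Y #> a \<longleftrightarrow> a \<otimes> x \<otimes> inv a \<in> Y"
  using assms by (simp add: coset_action_eq rcoset_eq_iff)

lemma permutation_group_coset_action:
  "permutation_group (U Mod Z) (rcosets Y) (coset_action U Y)"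
  unfolding permutation_group_def
proof
  show gr: "group (U Mod Z)" by (rule Z.factorgroup_is_group)
  have mult: "(Z #> x) <#> (Z #> y) = Z #> (x \<otimes> y)" if "x \<in> carrier U" "y \<in> carrier U" for x y
    using that by (rule Z.rcos_sum)
  show "faithful_action (opposite_group (U Mod Z)) (rcosets Y) (coset_action U Y)"
  proof (rule faithful_actionI[OF group_opposite_group[OF gr]])
    fix C assume C: "C \<in> carrier (opposite_group (U Mod Z))"
    then obtain x where x: "x \<in> carrier U" "C = Z #> x"
      using FactGroupE by (auto simp: opposite_group_def)
    show "coset_action U Y C \<in> extensional (rcosets Y)"
      using x by (simp add: coset_action_rcoset)
    {
      fix D assume "D \<in> rcosets Y"
      then obtain a where a: "a \<in> carrier U" "D = Y #> a" by (rule rcosetsE)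
      show "coset_action U Y C D \<in> rcosets Y"
        using x a by (simp add: coset_action_eq Z.rcosetsI Y.subset)
      fix C' assume C: "C' \<in> carrier (opposite_group (U Mod Z))"
      then obtain y where y: "y \<in> carrier U" "C' = Z #> y"
        using FactGroupE by (auto simp: opposite_group_def)
      show "coset_action U Y (C \<otimes>\<^bsub>opposite_group (U Mod Z)\<^esub> C') D = coset_action U Y C (coset_action U Y C' D)"
        using x y a by (simp add: opposite_group_def mult coset_action_eq Z.m_assoc)
    }
    assume triv: "\<And>D. D \<in> rcosets Y \<Longrightarrow> coset_action U Y C D = D"
    have "x \<in> Z"
    proof (rule core[OF x(1)])
      fix a assume a: "a \<in> carrier U"
      then show "a \<otimes> x \<otimes> inv a \<in> Y"
        using triv[of "Y #> a"] x coset_fix_iff[OF x(1) a] by (simp add: Z.rcosetsI Y.subset)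
    qed
    then show "C = \<one>\<^bsub>opposite_group (U Mod Z)\<^esub>"
      using x by (simp add: opposite_group_def Z.coset_join2 Z.subgroup_axioms)
  next
    fix D assume "D \<in> rcosets Y"
    then obtain a where a: "a \<in> carrier U" "D = Y #> a" by (rule rcosetsE)
    show "coset_action U Y \<one>\<^bsub>opposite_group (U Mod Z)\<^esub> D = D"
      using a coset_action_eq[of "\<one>" a] by (simp add: opposite_group_def Z.subset)
  qed
qed

text \<open>Normal subgroups of \<open>U Mod Z\<close> correspond to normal subgroups
  \<open>M\<close> of \<open>U\<close> containing \<open>Z\<close>. The first alternative says
  \<open>U = YM\<close>, which is transitivity of \<open>M\<close>. The second says that the
  stabiliser of the point \<open>Y\<close> in \<open>M\<close> acts trivially, and normality of
  \<open>M\<close> carries this over to every other point.\<close>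

lemma semiprimitive_coset_action:
  assumes dichotomy: "\<And>M. M \<lhd> U \<Longrightarrow> Z \<subseteq> M \<Longrightarrow>
    (\<forall>x\<in>carrier U. \<exists>y\<in>Y. \<exists>m\<in>M. x = y \<otimes> m) \<or> M \<inter> Y \<subseteq> Z"
  shows "semiprimitive (U Mod Z) (rcosets Y) (coset_action U Y)"
proof -
  interpret Q: group "U Mod Z" by (rule Z.factorgroup_is_group)
  interpret Q: perm_group "U Mod Z" "rcosets Y" "coset_action U Y"
    by unfold_locales (rule permutation_group_coset_action)
  have trans: "transitive_on (U Mod Z) (rcosets Y) (coset_action U Y) N"
    if N: "subgroup N (U Mod Z)" and cover: "\<forall>x\<in>carrier U. \<exists>y\<in>Y. \<exists>m\<in>\<Union>N. x = y \<otimes> m" for N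
  proof -
    interpret N: subgroup N "U Mod Z" by (rule N)
    \<comment> \<open>The point \<open>Y\<close> serves as base point: if
      \<open>b = y \<otimes> m\<close>, then the coset of \<open>m\<close> sends \<open>Y\<close> to
      \<open>Y #> m\<close>, which equals \<open>Y #> b\<close>.\<close>
    have base: "\<exists>C\<in>N. coset_action U Y C Y = D" if D: "D \<in> rcosets Y" for D
    proof -
      obtain b where b: "b \<in> carrier U" "D = Y #> b" using D by (rule rcosetsE)
      obtain y m C where ym: "y \<in> Y" "C \<in> N" "m \<in> C" "b = y \<otimes> m" using cover b by blast
      obtain c where c: "c \<in> carrier U" "C = Z #> c" using FactGroupE N.subset ym by blast
      have m: "m \<in> carrier U" and C: "C = Z #> m"
        using ym c Z.repr_independence[OF _ c(1) Z.subgroup_axioms] Z.r_coset_subset_G[OF Z.subset c(1)]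
        by auto
      have "coset_action U Y C Y = Y #> m"
        using coset_action_eq[of m "\<one>"] m C by (simp add: Y.subset)
      also have "\<dots> = Y #> b"
        using m ym b by (subst rcoset_eq_iff) (simp_all add: Z.m_assoc Z.inv_mult_group Z.mult_inv_cancel)
      finally show ?thesis using b ym by blast
    qed
    show ?thesis
    proof (subst Q.transitive_on_iff[OF N.subset], intro conjI ballI)
      show "rcosets Y \<noteq> {}" using Y.subgroup_in_rcosets[OF Z.is_group] by blast
      fix D D' assume D: "D \<in> rcosets Y" "D' \<in> rcosets Y"
      \<comment> \<open>Any coset is reached from any other by way of \<open>Y\<close>: back from
        \<open>D\<close> by the inverse of \<open>C\<close>, then on to \<open>D'\<close> by
        \<open>C'\<close>.\<close>
      obtain C C' where C: "C \<in> N" "coset_action U Y C Y = D" "C' \<in> N" "coset_action U Y C' Y = D'"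
        using base D by blast
      have Yr: "Y \<in> rcosets Y" using Y.subgroup_in_rcosets[OF Z.is_group] .
      have CX: "C \<in> carrier (U Mod Z)" "C' \<in> carrier (U Mod Z)" using C by auto
      have "coset_action U Y (inv\<^bsub>U Mod Z\<^esub> C \<otimes>\<^bsub>U Mod Z\<^esub> C') D = D'"
        using C D Q.act_mult[OF Q.inv_closed[OF CX(1)] CX(2) D(1)] Q.act_inv(1)[OF CX(1) Yr] by simp
      then show "\<exists>g\<in>N. coset_action U Y g D = D'"
        using C N.m_closed[OF N.m_inv_closed] by blast
    qed
  qed
  show ?thesis
    unfolding semiprimitive_def
  proof (intro conjI allI impI permutation_group_coset_action)
    show "transitive_on (U Mod Z) (rcosets Y) (coset_action U Y) (carrier (U Mod Z))"
    proof (rule trans[OF Q.subgroup_self], intro ballI)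
      fix x assume "x \<in> carrier U"
      moreover have "x \<in> \<Union>(carrier (U Mod Z))" if "x \<in> carrier U" for x
        using Z.rcos_self[OF that Z.subgroup_axioms] that by (auto simp: carrier_FactGroup)
      ultimately show "\<exists>y\<in>Y. \<exists>m\<in>\<Union>(carrier (U Mod Z)). x = y \<otimes> m"
        by (intro bexI[of _ \<one>] bexI[of _ x]) simp_all
    qed
  next
    fix N assume N: "N \<lhd> U Mod Z"
    interpret N: normal N "U Mod Z" by (rule N)
    \<comment> \<open>The members of \<open>N\<close> are cosets of \<open>Z\<close>, so
      \<open>\<Union>N\<close> is the full preimage of \<open>N\<close> in \<open>U\<close>.\<close>
    have M: "\<Union>N \<lhd> U" by (rule Z.factgroup_subgroup_union_normal[OF N])
    interpret M: normal "\<Union>N" U by (rule M)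
    have "Z \<in> N" using N.one_closed by simp
    then have "Z \<subseteq> \<Union>N" by blast
    from dichotomy[OF M this]
    show "transitive_on (U Mod Z) (rcosets Y) (coset_action U Y) N \<or>
          semiregular_on (U Mod Z) (rcosets Y) (coset_action U Y) N"
    proof (elim disjE, goal_cases)
      case 1
      then show ?case using trans[OF N.subgroup_axioms] by blast
    next
      case 2
      have "semiregular_on (U Mod Z) (rcosets Y) (coset_action U Y) N"
        unfolding semiregular_on_iff
      proof (intro ballI equalityI subsetI)
        fix D C assume D: "D \<in> rcosets Y" and C: "C \<in> {C \<in> N. coset_action U Y C D = D}"
        obtain a where a: "a \<in> carrier U" "D = Y #> a" using D by (rule rcosetsE)
        obtain x where x: "x \<in> carrier U" "C = Z #> x" using C FactGroupE N.subset by blast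
        have "x \<in> \<Union>N" using C x Z.rcos_self[OF x(1) Z.subgroup_axioms] by auto
        \<comment> \<open>Conjugation by \<open>a\<close> moves the fixed point
          \<open>Y #> a\<close> to the base point \<open>Y\<close>, where the hypothesis applies;
          normality of \<open>Z\<close> then brings the result back to \<open>x\<close>.\<close>
        then have "a \<otimes> x \<otimes> inv a \<in> \<Union>N" using M.inv_op_closed2 a by blast
        moreover have "a \<otimes> x \<otimes> inv a \<in> Y" using C x a coset_fix_iff by simp
        ultimately have "a \<otimes> x \<otimes> inv a \<in> Z" using 2 by blast
        then have "inv a \<otimes> (a \<otimes> x \<otimes> inv a) \<otimes> a \<in> Z" using Z.inv_op_closed1 a by blast
        then have "x \<in> Z" using a x by (simp add: Z.m_assoc Z.mult_inv_cancel)
        then show "C \<in> {\<one>\<^bsub>U Mod Z\<^esub>}" using x by (simp add: Z.coset_join2 Z.subgroup_axioms)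
      next
        fix D C assume "D \<in> rcosets Y" "C \<in> {\<one>\<^bsub>U Mod Z\<^esub>}"
        then show "C \<in> {C \<in> N. coset_action U Y C D = D}"
          using Q.act_one N.one_closed by auto
      qed
      then show ?case ..
    qed
  qed
qed

end

text \<open>This combines the orbit-stabiliser correspondence, pulled back along \<open>f\<close>,
  with the first isomorphism theorem: \<open>Y\<close> is the preimage of the stabiliser of
  \<alpha>, and \<open>G\<close> is identified with \<open>U\<close> modulo the kernel of
  \<open>f\<close>.\<close>

lemma (in perm_group) permutationally_isomorphic_coset_action:
  assumes f: "group_hom U G f" and surj: "f ` carrier U = carrier G"
    and \<alpha>: "\<alpha> \<in> \<Omega>" and trans: "transitive_on G \<Omega> \<phi> (carrier G)"
  defines "Y \<equiv> {x \<in> carrier U. \<phi> (f x) \<alpha> = \<alpha>}"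
  shows "permutationally_isomorphic G \<Omega> \<phi> (U Mod kernel U G f) (rcosets\<^bsub>U\<^esub> Y) (coset_action U Y)"
proof -
  interpret f: group_hom U G f by (rule f)
  define Z where "Z = kernel U G f"
  have Y: "subgroup Y U"
  proof (rule f.subgroupI)
    fix a b assume "a \<in> Y"
    then show "inv\<^bsub>U\<^esub> a \<in> Y" using act_inv(1)[of "f a" \<alpha>] \<alpha> by (simp add: Y_def)
    assume "b \<in> Y"
    then show "a \<otimes>\<^bsub>U\<^esub> b \<in> Y" using \<open>a \<in> Y\<close> act_mult[of "f a" "f b" \<alpha>] \<alpha> by (simp add: Y_def)
  next
    have "\<one>\<^bsub>U\<^esub> \<in> Y" using act_one \<alpha> by (simp add: Y_def)
    then show "Y \<noteq> {}" by blast
  qed (auto simp: Y_def)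
  interpret coset_space U Y Z
    using Y f.normal_kernel act_one \<alpha>
    by (auto simp: coset_space_def coset_space_axioms_def Z_def Y_def kernel_def)
  let ?\<psi>' = "\<lambda>C. the_elem (f ` C)"
  have iso': "?\<psi>' \<in> iso (U Mod Z) G"
    unfolding Z_def by (rule f.FactGroup_iso_set[OF surj])
  \<comment> \<open>The isomorphism theorem provides a map from the quotient to \<open>G\<close>,
    whereas a permutational isomorphism starting at \<open>G\<close> needs its inverse.\<close>
  define \<psi> where "\<psi> = inv_into (carrier (U Mod Z)) ?\<psi>'"
  have iso: "\<psi> \<in> iso G (U Mod Z)"
    unfolding \<psi>_def using group.iso_set_sym[OF Z.factorgroup_is_group iso'] .
  have \<psi>: "\<psi> (f x) = Z #>\<^bsub>U\<^esub> x" if x: "x \<in> carrier U" for x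
    unfolding \<psi>_def
  proof (rule inv_into_f_eq)
    show "inj_on ?\<psi>' (carrier (U Mod Z))" using iso' by (simp add: iso_def bij_betw_def)
    show "Z #>\<^bsub>U\<^esub> x \<in> carrier (U Mod Z)" using x by (auto simp: carrier_FactGroup)
    have "f z = f x" if "z \<in> Z #>\<^bsub>U\<^esub> x" for z
      using that x unfolding r_coset_def Z_def kernel_def by auto
    then have "f ` (Z #>\<^bsub>U\<^esub> x) = {f x}"
      using f.G.rcos_self[OF x Z.subgroup_axioms] by blast
    then show "?\<psi>' (Z #>\<^bsub>U\<^esub> x) = f x" by simp
  qed
  \<comment> \<open>Taking the whole fibre over a point avoids a choice of representative. Fibres
    over distinct points are disjoint, and transitivity makes them non-empty, so \<theta> is
    injective on \<Omega>.\<close>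
  define \<theta> where "\<theta> \<omega> = {x \<in> carrier U. \<phi> (f x) \<alpha> = \<omega>}" for \<omega>
  have \<theta>: "\<theta> (\<phi> (f x) \<alpha>) = Y #>\<^bsub>U\<^esub> x" if x: "x \<in> carrier U" for x
  proof -
    have "\<phi> (f y) \<alpha> = \<phi> (f x) \<alpha> \<longleftrightarrow> y \<otimes>\<^bsub>U\<^esub> inv\<^bsub>U\<^esub> x \<in> Y" if y: "y \<in> carrier U" for y
    proof -
      have eq: "\<phi> (f (y \<otimes>\<^bsub>U\<^esub> inv\<^bsub>U\<^esub> x)) \<alpha> = \<phi> (inv (f x)) (\<phi> (f y) \<alpha>)"
        using x y \<alpha> by (simp add: act_mult)
      have "y \<otimes>\<^bsub>U\<^esub> inv\<^bsub>U\<^esub> x \<in> carrier U" using x y by simp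
      then have "y \<otimes>\<^bsub>U\<^esub> inv\<^bsub>U\<^esub> x \<in> Y \<longleftrightarrow> \<phi> (inv (f x)) (\<phi> (f y) \<alpha>) = \<alpha>"
        unfolding Y_def mem_Collect_eq eq by blast
      also have "\<dots> \<longleftrightarrow> \<phi> (f y) \<alpha> = \<phi> (f x) \<alpha>"
        using act_inv[of "f x"] act_closed[of "f y" \<alpha>] \<alpha> x y by (metis f.hom_closed)
      finally show ?thesis ..
    qed
    then show ?thesis
      using x Y.rcos_module[OF f.G.is_group x] f.G.r_coset_subset_G[OF Y.subset x]
      by (auto simp: \<theta>_def)
  qed
  have points: "\<exists>x\<in>carrier U. \<omega> = \<phi> (f x) \<alpha>" if "\<omega> \<in> \<Omega>" for \<omega>
  proof -
    have "\<forall>\<omega>\<in>\<Omega>. \<forall>\<omega>'\<in>\<Omega>. \<exists>g\<in>carrier G. \<phi> g \<omega> = \<omega>'"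
      using trans transitive_on_iff[OF subset_refl] by simp
    with that \<alpha> obtain g where g: "g \<in> carrier G" "\<phi> g \<alpha> = \<omega>" by blast
    then have "g \<in> f ` carrier U" using surj by simp
    then show ?thesis using g by blast
  qed
  have "bij_betw \<theta> \<Omega> (rcosets\<^bsub>U\<^esub> Y)"
  proof (rule bij_betwI')
    fix \<omega> \<omega>' assume "\<omega> \<in> \<Omega>" "\<omega>' \<in> \<Omega>"
    then obtain x where x: "x \<in> carrier U" "\<omega> = \<phi> (f x) \<alpha>" using points by blast
    have "x \<in> \<theta> \<omega>" using x by (simp add: \<theta>_def)
    then show "\<theta> \<omega> = \<theta> \<omega>' \<longleftrightarrow> \<omega> = \<omega>'" by (auto simp: \<theta>_def)
  next
    fix \<omega> assume "\<omega> \<in> \<Omega>"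
    then obtain x where x: "x \<in> carrier U" "\<omega> = \<phi> (f x) \<alpha>" using points by blast
    then show "\<theta> \<omega> \<in> rcosets\<^bsub>U\<^esub> Y" using \<theta> unfolding RCOSETS_def by blast
  next
    fix D assume "D \<in> rcosets\<^bsub>U\<^esub> Y"
    then obtain x where "x \<in> carrier U" "D = Y #>\<^bsub>U\<^esub> x" by (rule rcosetsE)
    then show "\<exists>\<omega>\<in>\<Omega>. D = \<theta> \<omega>" using \<theta> act_closed \<alpha> f.hom_closed by metis
  qed
  moreover have "\<theta> (\<phi> g \<omega>) = coset_action U Y (\<psi> g) (\<theta> \<omega>)" if g\<omega>: "g \<in> carrier G" "\<omega> \<in> \<Omega>" for g \<omega>
  proof -
    have "g \<in> f ` carrier U" using g\<omega> surj by simp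
    then obtain x where x: "x \<in> carrier U" "g = f x" by blast
    obtain y where y: "y \<in> carrier U" "\<omega> = \<phi> (f y) \<alpha>" using g\<omega> points by blast
    have "\<phi> g \<omega> = \<phi> (f (y \<otimes>\<^bsub>U\<^esub> x)) \<alpha>" using x y \<alpha> by (simp add: act_mult)
    then have "\<theta> (\<phi> g \<omega>) = Y #>\<^bsub>U\<^esub> (y \<otimes>\<^bsub>U\<^esub> x)" using x y \<theta>[of "y \<otimes>\<^bsub>U\<^esub> x"] by simp
    then show ?thesis using x y by (simp add: \<theta> \<psi> coset_action_eq)
  qed
  ultimately show ?thesis
    using iso unfolding permutationally_isomorphic_def Z_def by blast
qed

section \<open>The semidirect product\<close>

lemma AutoGroup_simps:
  "carrier (AutoGroup K) = auto K"
  "\<one>\<^bsub>AutoGroup K\<^esub> = (\<lambda>k\<in>carrier K. k)"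
  "f \<in> auto K \<Longrightarrow> g \<in> auto K \<Longrightarrow> f \<otimes>\<^bsub>AutoGroup K\<^esub> g = compose (carrier K) f g"
  by (simp_all add: AutoGroup_def BijGroup_def auto_def)

lemma (in group) conj_auto_simps:
  "k \<in> carrier G \<Longrightarrow> conj_auto G x k = inv x \<otimes> k \<otimes> x"
  "conj_auto G x \<in> extensional (carrier G)"
  "conj_auto G \<one> = (\<lambda>k\<in>carrier G. k)"
  by (auto simp: conj_auto_def)

text \<open>Conjugation by a product conjugates by the left factor first, and \<open>compose\<close>
  writes the map applied first on the right.\<close>

lemma (in group) conj_auto_mult:
  assumes "x \<in> carrier G" "y \<in> carrier G"
  shows "conj_auto G (x \<otimes> y) = compose (carrier G) (conj_auto G y) (conj_auto G x)"
  using assms by (intro extensionalityI[where A = "carrier G"])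
    (simp_all add: conj_auto_simps compose_eq m_assoc inv_mult_group)

locale auto_subgroup = group K for K (structure) +
  fixes H
  assumes H: "subgroup H (AutoGroup K)"
begin

abbreviation S where "S \<equiv> semidirect K H"

lemma H_auto: "h \<in> H \<Longrightarrow> h \<in> auto K"
  using subgroup.subset[OF H] by (auto simp: AutoGroup_simps)

lemma H_ext: "h \<in> H \<Longrightarrow> h \<in> extensional (carrier K)"
  using H_auto by (auto simp: auto_def Bij_def)

lemma H_hom: "h \<in> H \<Longrightarrow> group_hom K K h"
  using H_auto is_group by (auto simp: auto_def group_hom_def group_hom_axioms_def)

lemma H_closed [simp]: "h \<in> H \<Longrightarrow> k \<in> carrier K \<Longrightarrow> h k \<in> carrier K"
  and H_mult: "h \<in> H \<Longrightarrow> k \<in> carrier K \<Longrightarrow> k' \<in> carrier K \<Longrightarrow> h (k \<otimes> k') = h k \<otimes> h k'"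
  and H_one [simp]: "h \<in> H \<Longrightarrow> h \<one> = \<one>"
  and H_inv: "h \<in> H \<Longrightarrow> k \<in> carrier K \<Longrightarrow> h (inv k) = inv (h k)"
  using group_hom.hom_closed[OF H_hom] group_hom.hom_mult[OF H_hom]
    group_hom.hom_one[OF H_hom] group_hom.hom_inv[OF H_hom] by blast+

lemma id_in_H [simp]: "(\<lambda>k\<in>carrier K. k) \<in> H"
  using subgroup.one_closed[OF H] by (simp add: AutoGroup_simps)

lemma compose_in_H [simp]: "h \<in> H \<Longrightarrow> h' \<in> H \<Longrightarrow> compose (carrier K) h h' \<in> H"
  using subgroup.m_closed[OF H, of h h'] H_auto by (simp add: AutoGroup_simps)

lemma H_inverse:
  assumes "h \<in> H"
  obtains h' where "h' \<in> H" "compose (carrier K) h' h = (\<lambda>k\<in>carrier K. k)"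
    "compose (carrier K) h h' = (\<lambda>k\<in>carrier K. k)"
proof -
  interpret A: group "AutoGroup K" by (rule AutoGroup)
  let ?h' = "inv\<^bsub>AutoGroup K\<^esub> h"
  have h: "h \<in> carrier (AutoGroup K)" using assms H_auto by (simp add: AutoGroup_simps)
  have h': "?h' \<in> H" using subgroup.m_inv_closed[OF H assms] .
  show thesis
    using that[OF h'] A.l_inv[OF h] A.r_inv[OF h] H_auto[OF h'] H_auto[OF assms]
    by (simp add: AutoGroup_simps)
qed

lemma H_eqI:
  assumes "h \<in> H" "h' \<in> H" "\<And>k. k \<in> carrier K \<Longrightarrow> h k = h' k"
  shows "h = h'"
  using extensionalityI[OF H_ext[OF assms(1)] H_ext[OF assms(2)]] assms(3) .

lemma carrier_semidirect [simp]: "carrier S = H \<times> carrier K"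
  and one_semidirect: "\<one>\<^bsub>S\<^esub> = (\<lambda>k\<in>carrier K. k, \<one>)"
  and mult_semidirect: "(h, k) \<otimes>\<^bsub>S\<^esub> (h', k') = (compose (carrier K) h' h, h' k \<otimes> k')"
  by (simp_all add: semidirect_def)

lemma group_semidirect: "group S"
proof (rule groupI)
  fix x y z assume xyz: "x \<in> carrier S" "y \<in> carrier S" "z \<in> carrier S"
  show "x \<otimes>\<^bsub>S\<^esub> y \<otimes>\<^bsub>S\<^esub> z = x \<otimes>\<^bsub>S\<^esub> (y \<otimes>\<^bsub>S\<^esub> z)"
    using xyz by (cases x; cases y; cases z)
      (auto simp: mult_semidirect m_assoc H_mult compose_eq intro!: H_eqI)
next
  fix x assume x: "x \<in> carrier S"
  obtain h k where hk: "x = (h, k)" "h \<in> H" "k \<in> carrier K" using x by auto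
  obtain h' where h': "h' \<in> H" "compose (carrier K) h' h = (\<lambda>k\<in>carrier K. k)"
    "compose (carrier K) h h' = (\<lambda>k\<in>carrier K. k)"
    using H_inverse[OF hk(2)] .
  \<comment> \<open>The second component of \<open>(h', j) \<otimes> (h, k)\<close> is
    \<open>h j \<otimes> k\<close>, so a left inverse of \<open>(h, k)\<close> requires
    \<open>h j = inv k\<close>, that is, \<open>j = h' (inv k)\<close>.\<close>
  have "h (h' (inv k)) = inv k"
    using fun_cong[OF h'(3), of "inv k"] hk by (simp add: compose_eq)
  then have "(h', h' (inv k)) \<otimes>\<^bsub>S\<^esub> x = \<one>\<^bsub>S\<^esub>"
    using hk h' by (simp add: mult_semidirect one_semidirect)
  then show "\<exists>y\<in>carrier S. y \<otimes>\<^bsub>S\<^esub> x = \<one>\<^bsub>S\<^esub>"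
    using hk h' by (intro bexI[of _ "(h', h' (inv k))"]) simp_all
  show "\<one>\<^bsub>S\<^esub> \<otimes>\<^bsub>S\<^esub> x = x"
    using hk by (auto simp: mult_semidirect one_semidirect compose_eq intro!: H_eqI)
qed (auto simp: mult_semidirect one_semidirect)

sublocale S: group S by (rule group_semidirect)

section \<open>Invariant subsets of \<open>K\<close> and the preimage of \<open>H\<close> under
  conjugation\<close>

lemma invariant_mem_iff:
  assumes R: "invariant_under H R" and sub: "R \<subseteq> carrier K" and h: "h \<in> H" and k: "k \<in> carrier K"
  shows "h k \<in> R \<longleftrightarrow> k \<in> R"
proof
  have inj: "inj_on h (carrier K)" using H_auto[OF h] by (auto simp: auto_def Bij_def bij_betw_def)
  assume "h k \<in> R"
  then have "h k \<in> h ` R" using R h by (simp add: invariant_under_def)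
  then show "k \<in> R" using inj k sub by (auto simp: inj_on_def)
next
  assume "k \<in> R"
  then show "h k \<in> R" using R h by (auto simp: invariant_under_def)
qed

text \<open>This turns the set images in \<open>faithful_on_quotient\<close> into computations with
  coset representatives.\<close>

lemma image_rcoset:
  assumes R: "invariant_under H R" and sub: "R \<subseteq> carrier K" and h: "h \<in> H" and k: "k \<in> carrier K"
  shows "h ` (R #> k) = R #> h k"
proof -
  have "h ` (R #> k) = (\<lambda>r. h r \<otimes> h k) ` R"
    using sub h k by (force simp: r_coset_def H_mult)
  also have "\<dots> = (\<lambda>r. r \<otimes> h k) ` (h ` R)"
    by (simp add: image_image)
  also have "\<dots> = R #> h k"
    using R h by (auto simp: invariant_under_def r_coset_def)
  finally show ?thesis .
qed

text \<open>Conjugation turns products in \<open>K\<close> into composites of automorphisms, so the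
  preimage of the subgroup \<open>H\<close> is a subgroup. For inverses, the inverse of
  \<open>conj_auto K a\<close> that \<open>H\<close> provides is identified pointwise with
  conjugation by \<open>inv a\<close>.\<close>

lemma subgroup_conj_preimage: "subgroup (conj_preimage K H) K"
proof (rule subgroupI)
  show "conj_preimage K H \<noteq> {}" by (auto simp: conj_preimage_def conj_auto_simps intro!: exI[of _ \<one>])
  fix a assume a: "a \<in> conj_preimage K H"
  then have aK: "a \<in> carrier K" and aH: "conj_auto K a \<in> H" by (auto simp: conj_preimage_def)
  obtain h' where h': "h' \<in> H" "compose (carrier K) (conj_auto K a) h' = (\<lambda>k\<in>carrier K. k)"
    using H_inverse[OF aH] by metis
  have "h' k = conj_auto K (inv a) k" if k: "k \<in> carrier K" for k
  proof -
    have "inv a \<otimes> h' k \<otimes> a = k"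
      using fun_cong[OF h'(2), of k] k h'(1) aK by (simp add: compose_eq conj_auto_simps)
    then have "a \<otimes> k \<otimes> inv a = a \<otimes> (inv a \<otimes> h' k \<otimes> a) \<otimes> inv a" by simp
    then show ?thesis using aK k h' by (simp add: conj_auto_simps m_assoc mult_inv_cancel)
  qed
  then have "h' = conj_auto K (inv a)"
    by (intro extensionalityI[OF H_ext[OF h'(1)] conj_auto_simps(2)])
  then show "inv a \<in> conj_preimage K H" using aK h' by (simp add: conj_preimage_def)
  fix b assume "b \<in> conj_preimage K H"
  then show "a \<otimes> b \<in> conj_preimage K H" using a by (simp add: conj_preimage_def conj_auto_mult)
qed (auto simp: conj_preimage_def)

end

section \<open>From triples to semiprimitive groups\<close>

locale triple = auto_subgroup +
  fixes L
  assumes semiprimitive_triple: "semiprimitive_triple K H L"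
begin

lemma L_subgroup: "subgroup L K"
  using semiprimitive_triple group.incl_subgroup[OF is_group subgroup_conj_preimage normal_imp_subgroup]
  by (simp add: semiprimitive_triple_def)

lemma L_conj: "u \<in> L \<Longrightarrow> conj_auto K u \<in> H"
  using semiprimitive_triple subgroup.subset[OF normal_imp_subgroup]
  by (fastforce simp: semiprimitive_triple_def conj_preimage_def)

lemma L_invariant: "invariant_under H L"
  using semiprimitive_triple by (simp add: semiprimitive_triple_def)

lemma L_core_free: "core_free K L"
  using semiprimitive_triple by (simp add: semiprimitive_triple_def)

lemma H_faithful:
  "R \<lhd> K \<Longrightarrow> R \<noteq> carrier K \<Longrightarrow> invariant_under H R \<Longrightarrow> faithful_on_quotient K H R"
  using semiprimitive_triple by (simp add: semiprimitive_triple_def)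

sublocale L: subgroup L K by (rule L_subgroup)

section \<open>The point stabiliser \<open>Y\<close> and the kernel \<open>Z\<close> in the
  semidirect product\<close>

abbreviation Y where "Y \<equiv> triple_stabilizer K H L"
abbreviation Z where "Z \<equiv> triple_kernel K L"

lemma triple_stabilizer_eq: "Y = H \<times> L"
proof (intro equalityI subsetI)
  fix x assume "x \<in> Y"
  then show "x \<in> H \<times> L"
    using L.subset by (auto simp: triple_stabilizer_def set_mult_def mult_semidirect)
next
  fix x assume "x \<in> H \<times> L"
  then obtain h u where hu: "x = (h, u)" "h \<in> H" "u \<in> L" by auto
  have "compose (carrier K) (\<lambda>k\<in>carrier K. k) h = h"
    using hu by (intro H_eqI) (simp_all add: compose_eq)
  then have "x = (h, \<one>) \<otimes>\<^bsub>S\<^esub> (\<lambda>k\<in>carrier K. k, u)"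
    using hu by (simp add: mult_semidirect)
  then show "x \<in> Y" using hu unfolding triple_stabilizer_def set_mult_def by blast
qed

text \<open>Products stay in \<open>H \<times> L\<close> because their second component is
  \<open>h' u \<otimes> u'\<close> and \<open>L\<close> is \<open>H\<close>-invariant. For an
  inverse \<open>(h', k)\<close> of \<open>(h, u)\<close>, the equation \<open>h k = inv u\<close>
  puts \<open>h k\<close> in \<open>L\<close>, and invariance then puts \<open>k\<close>
  there.\<close>

lemma stabilizer_subgroup: "subgroup Y S"
proof (rule S.subgroupI)
  show "Y \<subseteq> carrier S" using L.subset by (auto simp: triple_stabilizer_eq)
  show "Y \<noteq> {}" using id_in_H L.one_closed unfolding triple_stabilizer_eq by blast
  fix x assume "x \<in> Y"
  then obtain h u where hu: "x = (h, u)" "h \<in> H" "u \<in> L" by (auto simp: triple_stabilizer_eq)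
  have xS: "x \<in> carrier S" using hu by simp
  obtain h' k where i: "inv\<^bsub>S\<^esub> x = (h', k)" "h' \<in> H" "k \<in> carrier K"
    using S.inv_closed[OF xS] by (cases "inv\<^bsub>S\<^esub> x") auto
  have "h k \<otimes> u = \<one>"
    using S.l_inv[OF xS, unfolded i(1), unfolded hu(1)] by (simp add: mult_semidirect one_semidirect)
  then have "h k = inv u" using hu i by (simp add: inv_equality)
  then have "h k \<in> L" using hu by simp
  then have "k \<in> L" using invariant_mem_iff[OF L_invariant L.subset] hu i by simp
  then show "inv\<^bsub>S\<^esub> x \<in> Y" using i by (simp add: triple_stabilizer_eq)
  fix y assume "y \<in> Y"
  then show "x \<otimes>\<^bsub>S\<^esub> y \<in> Y"
    using hu invariant_mem_iff[OF L_invariant L.subset] by (auto simp: triple_stabilizer_eq mult_semidirect)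
qed

lemma kernel_mem_iff: "(h, u) \<in> Z \<longleftrightarrow> u \<in> L \<and> h = conj_auto K (inv u)"
  by (auto simp: triple_kernel_def)

lemma kernel_subset: "Z \<subseteq> Y"
  using L_conj by (auto simp: triple_stabilizer_eq kernel_mem_iff)

text \<open>Write z(u) for the element of \<open>Z\<close> with second component \<open>u\<close>.
  Then z(u)z(v) = z(vu), which gives a subgroup. Moreover z(u) centralises \<open>K\<close>, and
  passing it across \<open>x = (h, k)\<close> only replaces \<open>u\<close> by \<open>h u\<close>;
  as \<open>h\<close> permutes \<open>L\<close>, left and right cosets agree.\<close>

lemma kernel_normal: "Z \<lhd> S"
proof (rule S.normalI)
  have mult: "(conj_auto K (inv u), u) \<otimes>\<^bsub>S\<^esub> (conj_auto K (inv v), v) = (conj_auto K (inv (v \<otimes> u)), v \<otimes> u)"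
    if "u \<in> L" "v \<in> L" for u v
    using that by (simp add: mult_semidirect inv_mult_group flip: conj_auto_mult)
      (simp add: conj_auto_simps m_assoc)
  show "subgroup Z S"
  proof (rule S.subgroupI)
    show "Z \<subseteq> carrier S" using kernel_subset subgroup.subset[OF stabilizer_subgroup] by blast
    show "Z \<noteq> {}" using L.one_closed unfolding triple_kernel_def by blast
    fix x assume "x \<in> Z"
    then obtain u where u: "x = (conj_auto K (inv u), u)" "u \<in> L" by (auto simp: triple_kernel_def)
    have "inv\<^bsub>S\<^esub> x = (conj_auto K (inv (inv u)), inv u)"
    proof (rule S.inv_equality)
      show "(conj_auto K (inv (inv u)), inv u) \<otimes>\<^bsub>S\<^esub> x = \<one>\<^bsub>S\<^esub>"
        using mult[of "inv u" u] u by (simp add: one_semidirect conj_auto_simps)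
      show "x \<in> carrier S" "(conj_auto K (inv (inv u)), inv u) \<in> carrier S"
        using u L_conj[of u] L_conj[of "inv u"] by simp_all
    qed
    then show "inv\<^bsub>S\<^esub> x \<in> Z" using u by (simp add: kernel_mem_iff)
    fix y assume "y \<in> Z"
    then obtain v where v: "y = (conj_auto K (inv v), v)" "v \<in> L" by (auto simp: triple_kernel_def)
    then show "x \<otimes>\<^bsub>S\<^esub> y \<in> Z" using u v mult by (simp add: kernel_mem_iff)
  qed
  show "\<forall>x\<in>carrier S. Z #>\<^bsub>S\<^esub> x = x <#\<^bsub>S\<^esub> Z"
  proof
    fix x assume "x \<in> carrier S"
    then obtain h k where x: "x = (h, k)" "h \<in> H" "k \<in> carrier K" by auto
    have comm: "(conj_auto K (inv u), u) \<otimes>\<^bsub>S\<^esub> x = x \<otimes>\<^bsub>S\<^esub> (conj_auto K (inv (h u)), h u)" if u: "u \<in> L" for u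
    proof -
      have hu: "h u \<in> L" using u x invariant_mem_iff[OF L_invariant L.subset] by simp
      have "compose (carrier K) h (conj_auto K (inv u)) = compose (carrier K) (conj_auto K (inv (h u))) h"
        using u x by (intro extensionalityI[where A = "carrier K"])
          (simp_all add: compose_eq conj_auto_simps H_mult H_inv)
      then show ?thesis
        using u x hu by (simp add: mult_semidirect conj_auto_simps m_assoc)
    qed
    have "Z #>\<^bsub>S\<^esub> x = (\<lambda>u. (conj_auto K (inv u), u) \<otimes>\<^bsub>S\<^esub> x) ` L"
      by (auto simp: r_coset_def triple_kernel_def)
    also have "\<dots> = (\<lambda>u. x \<otimes>\<^bsub>S\<^esub> (conj_auto K (inv (h u)), h u)) ` L"
      using comm by (rule image_cong[OF refl])
    also have "\<dots> = (\<lambda>u. x \<otimes>\<^bsub>S\<^esub> (conj_auto K (inv u), u)) ` (h ` L)"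
      by (simp add: image_image)
    also have "h ` L = L" using L_invariant x by (simp add: invariant_under_def)
    also have "(\<lambda>u. x \<otimes>\<^bsub>S\<^esub> (conj_auto K (inv u), u)) ` L = x <#\<^bsub>S\<^esub> Z"
      by (auto simp: l_coset_def triple_kernel_def)
    finally show "Z #>\<^bsub>S\<^esub> x = x <#\<^bsub>S\<^esub> Z" .
  qed
qed

sublocale coset_space S Y Z
  by (simp add: coset_space_def coset_space_axioms_def stabilizer_subgroup kernel_normal kernel_subset)

text \<open>Conjugation by \<open>u \<in> L\<close> belongs to \<open>H\<close>, so it can be
  absorbed into the first component, leaving a factor in \<open>Z\<close>. This is
  \<open>HL = HZ\<close>; it reduces questions about \<open>Y\<close> modulo \<open>Z\<close> to
  elements of \<open>H\<close>.\<close>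

lemma stabilizer_factor:
  assumes "x \<in> Y"
  obtains h z where "h \<in> H" "z \<in> Z" "x = (h, \<one>) \<otimes>\<^bsub>S\<^esub> z"
proof -
  obtain h u where x: "x = (h, u)" "h \<in> H" "u \<in> L" using assms by (auto simp: triple_stabilizer_eq)
  let ?h = "compose (carrier K) (conj_auto K u) h"
  have h': "?h \<in> H" using x L_conj by simp
  have "compose (carrier K) (conj_auto K (inv u)) ?h = h"
    using x h' L_conj[of "inv u"]
    by (intro H_eqI) (simp_all add: compose_eq conj_auto_simps m_assoc mult_inv_cancel)
  then have "x = (?h, \<one>) \<otimes>\<^bsub>S\<^esub> (conj_auto K (inv u), u)"
    using x by (simp add: mult_semidirect conj_auto_simps)
  then show thesis by (rule that[OF h', rotated]) (use x in \<open>simp add: kernel_mem_iff\<close>)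
qed

text \<open>Conjugating \<open>(h, \<one>)\<close> by an element of \<open>K\<close> keeps the first
  component and puts a commutator in the second. If both elements lie in a subgroup of
  \<open>S\<close>, so does that commutator.\<close>

lemma commutator_mult:
  assumes "h \<in> H" "k \<in> carrier K"
  shows "(\<lambda>k\<in>carrier K. k, k) \<otimes>\<^bsub>S\<^esub> (h, \<one>) \<otimes>\<^bsub>S\<^esub> inv\<^bsub>S\<^esub> (\<lambda>k\<in>carrier K. k, k) = (h, h k \<otimes> inv k)"
proof -
  have "(h, h k \<otimes> inv k) \<otimes>\<^bsub>S\<^esub> (\<lambda>k\<in>carrier K. k, k) = (\<lambda>k\<in>carrier K. k, k) \<otimes>\<^bsub>S\<^esub> (h, \<one>)"
    using assms by (auto simp: mult_semidirect m_assoc compose_eq intro!: H_eqI)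
  moreover have "(\<lambda>k\<in>carrier K. k, k) \<in> carrier S" "(h, h k \<otimes> inv k) \<in> carrier S" "(h, \<one>) \<in> carrier S"
    using assms by simp_all
  ultimately show ?thesis by (metis S.inv_solve_right S.m_closed)
qed

text \<open>By \<open>stabilizer_factor\<close> the matter reduces to \<open>(h, \<one>)\<close>,
  whose conjugates lie in \<open>Y\<close> because those of \<open>z\<close> do. Hence every
  \<open>h k \<otimes> inv k\<close> is in \<open>L\<close>, and in fact in every conjugate of
  \<open>L\<close>, so core-freeness forces \<open>h\<close> to be the identity.\<close>

lemma kernel_core:
  assumes x: "x \<in> carrier S" and conj: "\<And>a. a \<in> carrier S \<Longrightarrow> a \<otimes>\<^bsub>S\<^esub> x \<otimes>\<^bsub>S\<^esub> inv\<^bsub>S\<^esub> a \<in> Y"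
  shows "x \<in> Z"
proof -
  have "x \<in> Y" using conj[OF S.one_closed] x by simp
  then obtain h z where hz: "h \<in> H" "z \<in> Z" "x = (h, \<one>) \<otimes>\<^bsub>S\<^esub> z" by (rule stabilizer_factor)
  have comm: "h k \<otimes> inv k \<in> L" if k: "k \<in> carrier K" for k
  proof -
    let ?a = "(\<lambda>k\<in>carrier K. k, k)"
    have a: "?a \<in> carrier S" using k by simp
    have h: "(h, \<one>) \<in> carrier S" using hz by simp
    have z: "z \<in> carrier S" by (rule Z.mem_carrier[OF hz(2)])
    have "?a \<otimes>\<^bsub>S\<^esub> (h, \<one>) \<otimes>\<^bsub>S\<^esub> inv\<^bsub>S\<^esub> ?a =
      (?a \<otimes>\<^bsub>S\<^esub> x \<otimes>\<^bsub>S\<^esub> inv\<^bsub>S\<^esub> ?a) \<otimes>\<^bsub>S\<^esub> inv\<^bsub>S\<^esub> (?a \<otimes>\<^bsub>S\<^esub> z \<otimes>\<^bsub>S\<^esub> inv\<^bsub>S\<^esub> ?a)"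
      using S.inv_closed[OF a] a h z unfolding hz(3)
      by (simp del: carrier_semidirect add: S.m_assoc S.inv_mult_group S.mult_inv_cancel)
    moreover have "?a \<otimes>\<^bsub>S\<^esub> z \<otimes>\<^bsub>S\<^esub> inv\<^bsub>S\<^esub> ?a \<in> Y"
      using Z.inv_op_closed2[OF a hz(2)] kernel_subset by blast
    ultimately have "(h, h k \<otimes> inv k) \<in> Y"
      using commutator_mult[OF hz(1) k] conj[OF a] by (metis Y.m_closed Y.m_inv_closed)
    then show ?thesis by (simp add: triple_stabilizer_eq)
  qed
  have "h k = k" if k: "k \<in> carrier K" for k
  proof -
    define m where "m = h k \<otimes> inv k"
    have m: "m \<in> carrier K" using k hz by (simp add: m_def)
    have "m \<in> inv j <# L #> j" if j: "j \<in> carrier K" for j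
    proof -
      \<comment> \<open>The map sending \<open>k\<close> to \<open>h k \<otimes> inv k\<close>
        satisfies a cocycle identity. Two of the three terms are known to be in \<open>L\<close>, so
        the third, the conjugate of \<open>m\<close> by \<open>j\<close>, is too.\<close>
      have "h (j \<otimes> k) \<otimes> inv (j \<otimes> k) = (h j \<otimes> inv j) \<otimes> (j \<otimes> m \<otimes> inv j)"
        using j k hz by (simp add: m_def H_mult inv_mult_group m_assoc mult_inv_cancel)
      then have "j \<otimes> m \<otimes> inv j = inv (h j \<otimes> inv j) \<otimes> (h (j \<otimes> k) \<otimes> inv (j \<otimes> k))"
        using j k m hz by (simp add: mult_inv_cancel)
      also have "\<dots> \<in> L"
        by (rule L.m_closed[OF L.m_inv_closed[OF comm[OF j]] comm[OF m_closed[OF j k]]])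
      finally have "inv j \<otimes> (j \<otimes> m \<otimes> inv j) \<otimes> j \<in> inv j <# L #> j"
        unfolding l_coset_def r_coset_def by blast
      then show ?thesis using j m by (simp add: m_assoc mult_inv_cancel)
    qed
    then have "m \<in> {\<one>}" using L_core_free unfolding core_free_def by blast
    then have "inv (inv k) = h k" using k hz by (intro inv_equality) (simp_all add: m_def)
    then show ?thesis using k by simp
  qed
  then have "h = (\<lambda>k\<in>carrier K. k)" using hz by (intro H_eqI) simp_all
  then have "(h, \<one>) = \<one>\<^bsub>S\<^esub>" by (simp add: one_semidirect)
  then show ?thesis using hz Z.mem_carrier by (metis S.l_one)
qed

sublocale core_coset_space S Y Z
  by unfold_locales (rule kernel_core)

text \<open>The intersection \<open>R\<close> of \<open>M\<close> with \<open>K\<close> is normal in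
  \<open>K\<close> and \<open>H\<close>-invariant. If it is all of \<open>K\<close>, then
  \<open>M\<close> together with \<open>H\<close> covers \<open>S\<close>. Otherwise
  \<open>H\<close> is faithful on \<open>K Mod R\<close>, while elements of \<open>M\<close> coming
  from \<open>H\<close> act trivially there.\<close>

lemma normal_dichotomy:
  assumes M: "M \<lhd> S" and ZM: "Z \<subseteq> M"
  shows "(\<forall>x\<in>carrier S. \<exists>y\<in>Y. \<exists>m\<in>M. x = y \<otimes>\<^bsub>S\<^esub> m) \<or> M \<inter> Y \<subseteq> Z"
proof -
  interpret M: normal M S by (rule M)
  let ?id = "\<lambda>k\<in>carrier K. k"
  define R where "R = {k \<in> carrier K. (?id, k) \<in> M}"
  have id_mult: "(?id, a) \<otimes>\<^bsub>S\<^esub> (?id, b) = (?id, a \<otimes> b)" if "a \<in> carrier K" "b \<in> carrier K" for a b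
    using that by (auto simp: mult_semidirect compose_eq intro!: H_eqI)
  have id_inv: "inv\<^bsub>S\<^esub> (?id, a) = (?id, inv a)" if "a \<in> carrier K" for a
    using that by (intro S.inv_equality) (simp_all add: id_mult one_semidirect)
  have h_mult: "(h, \<one>) \<otimes>\<^bsub>S\<^esub> (?id, k) = (h, k)" if "h \<in> H" "k \<in> carrier K" for h k
    using that by (auto simp: mult_semidirect compose_eq intro!: H_eqI)
  have R_normal: "R \<lhd> K"
  proof (subst normal_inv_iff, intro conjI ballI)
    show "subgroup R K"
    proof (rule subgroupI)
      show "R \<noteq> {}" using M.one_closed by (auto simp: R_def one_semidirect)
      fix a assume "a \<in> R"
      then show "inv a \<in> R" using M.m_inv_closed[of "(?id, a)"] by (simp add: R_def id_inv)
      fix b assume "b \<in> R"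
      then show "a \<otimes> b \<in> R" using \<open>a \<in> R\<close> M.m_closed[of "(?id, a)" "(?id, b)"]
        by (simp add: R_def id_mult)
    qed (auto simp: R_def)
    fix k r assume "k \<in> carrier K" "r \<in> R"
    then show "k \<otimes> r \<otimes> inv k \<in> R"
      using M.inv_op_closed2[of "(?id, k)" "(?id, r)"] by (simp add: R_def id_mult id_inv)
  qed
  have R_sub: "R \<subseteq> carrier K" by (auto simp: R_def)
  have R_image: "h r \<in> R" if h: "h \<in> H" and r: "r \<in> R" for h r
  proof -
    have rK: "r \<in> carrier K" using r R_sub by blast
    \<comment> \<open>Inside the semidirect product, applying \<open>h\<close> to an element of
      \<open>K\<close> is conjugation by \<open>(h, \<one>)\<close>, so normality of
      \<open>M\<close> makes \<open>R\<close> invariant.\<close>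
    have "(?id, r) \<otimes>\<^bsub>S\<^esub> (h, \<one>) = (h, \<one>) \<otimes>\<^bsub>S\<^esub> (?id, h r)"
      using h rK by (auto simp: mult_semidirect compose_eq intro!: H_eqI)
    then have "inv\<^bsub>S\<^esub> (h, \<one>) \<otimes>\<^bsub>S\<^esub> (?id, r) \<otimes>\<^bsub>S\<^esub> (h, \<one>) = (?id, h r)"
    proof -
      have "(h, \<one>) \<in> carrier S" "(?id, r) \<in> carrier S" "(?id, h r) \<in> carrier S" using h rK by simp_all
      with \<open>_ = (h, \<one>) \<otimes>\<^bsub>S\<^esub> (?id, h r)\<close> show ?thesis
        by (simp del: carrier_semidirect add: S.m_assoc S.mult_inv_cancel)
    qed
    then have "(?id, h r) \<in> M"
      using M.inv_op_closed1[of "(h, \<one>)" "(?id, r)"] h r by (simp add: R_def)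
    then show ?thesis using h rK by (simp add: R_def)
  qed
  have R_inv: "invariant_under H R"
    unfolding invariant_under_def
  proof (intro ballI equalityI subsetI)
    fix h r assume h: "h \<in> H" and r: "r \<in> R"
    obtain h' where h': "h' \<in> H" "compose (carrier K) h h' = ?id" using H_inverse[OF h] by metis
    have "h (h' r) = r" using fun_cong[OF h'(2), of r] r R_sub by (auto simp: compose_eq)
    then show "r \<in> h ` R" using R_image[OF h'(1) r] by force
  qed (use R_image in blast)
  show ?thesis
  proof (cases "R = carrier K")
    case True
    have "\<exists>y\<in>Y. \<exists>m\<in>M. x = y \<otimes>\<^bsub>S\<^esub> m" if x: "x \<in> carrier S" for x
    proof -
      obtain h k where hk: "x = (h, k)" "h \<in> H" "k \<in> carrier K" using x by auto
      then have "(?id, k) \<in> M" "(h, \<one>) \<in> Y" using True by (auto simp: R_def triple_stabilizer_eq)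
      then show ?thesis using h_mult hk by force
    qed
    then show ?thesis by blast
  next
    case False
    interpret R: normal R K by (rule R_normal)
    have "inj_on (\<lambda>h. \<lambda>C\<in>carrier (K Mod R). h ` C) H"
      using faithful_action.faithful[OF H_faithful[OF R_normal False R_inv, unfolded faithful_on_quotient_def]]
      by simp
    moreover have "x \<in> Z" if x: "x \<in> M" "x \<in> Y"
      and inj: "inj_on (\<lambda>h. \<lambda>C\<in>carrier (K Mod R). h ` C) H" for x
    proof -
      obtain h z where hz: "h \<in> H" "z \<in> Z" "x = (h, \<one>) \<otimes>\<^bsub>S\<^esub> z" using x(2) by (rule stabilizer_factor)
      have h1: "(h, \<one>) \<in> carrier S" using hz by simp
      \<comment> \<open>As \<open>z\<close> lies in \<open>Z\<close>, hence in \<open>M\<close>, the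
        factor of \<open>x\<close> coming from \<open>H\<close> is in \<open>M\<close> as
        well.\<close>
      have "(h, \<one>) = x \<otimes>\<^bsub>S\<^esub> inv\<^bsub>S\<^esub> z"
        using hz h1 Z.mem_carrier by (metis S.inv_solve_right S.m_closed)
      moreover have "z \<in> M" using hz ZM by blast
      ultimately have hM: "(h, \<one>) \<in> M" using M.m_closed[OF x(1) M.m_inv_closed] by simp
      have "h ` C = ?id ` C" if C: "C \<in> carrier (K Mod R)" for C
      proof -
        obtain k where k: "k \<in> carrier K" "C = R #> k" using C by (auto simp: carrier_FactGroup)
        have "(h, h k \<otimes> inv k) \<in> M"
          using M.inv_op_closed2[OF _ hM, of "(?id, k)"] commutator_mult[OF hz(1) k(1)] k by simp
        \<comment> \<open>Cancelling \<open>(h, \<one>)\<close> leaves the commutator in both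
          \<open>M\<close> and \<open>K\<close>, hence in \<open>R\<close>; so \<open>h\<close>
          fixes the coset of \<open>k\<close>.\<close>
        then have "inv\<^bsub>S\<^esub> (h, \<one>) \<otimes>\<^bsub>S\<^esub> ((h, \<one>) \<otimes>\<^bsub>S\<^esub> (?id, h k \<otimes> inv k)) \<in> M"
          using hM hz k by (simp add: h_mult)
        then have "(?id, h k \<otimes> inv k) \<in> M"
          using hz k by (simp add: S.mult_inv_cancel)
        moreover have "h k \<otimes> inv k \<in> carrier K" using hz(1) k(1) by simp
        ultimately have "h k \<otimes> inv k \<in> R" unfolding R_def by blast
        then have "h k \<in> R #> k" using R.rcos_module[OF is_group k(1) H_closed[OF hz(1) k(1)]] by blast
        then have "R #> h k = R #> k" using repr_independence[OF _ k(1) R.subgroup_axioms] by simp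
        moreover have "?id ` C = C" using k(2) r_coset_subset_G[OF R_sub k(1)] by auto
        ultimately show ?thesis using image_rcoset[OF R_inv R_sub hz(1) k(1)] k by simp
      qed
      then have "h = ?id" using inj hz by (auto simp: inj_on_def cong: restrict_cong)
      then have "(h, \<one>) = \<one>\<^bsub>S\<^esub>" by (simp add: one_semidirect)
      then show ?thesis using hz Z.mem_carrier by (metis S.l_one)
    qed
    ultimately show ?thesis by blast
  qed
qed

lemma triple_action_eq: "triple_action K H L = coset_action S Y"
  by (simp add: fun_eq_iff triple_action_def coset_action_def triple_points_def)

lemma semiprimitive: "semiprimitive (triple_group K H L) (triple_points K H L) (triple_action K H L)"
  using semiprimitive_coset_action[OF normal_dichotomy]
  by (simp add: triple_group_def triple_points_def triple_action_eq)

end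

section \<open>From semiprimitive groups to triples\<close>

locale pointed_plinth = perm_group +
  fixes P \<alpha>
  assumes semiprimitive: "semiprimitive G \<Omega> \<phi>" and plinth: "plinth G \<Omega> \<phi> P" and \<alpha>: "\<alpha> \<in> \<Omega>"
begin

lemma P_normal: "P \<lhd> G"
  using plinth by (simp add: plinth_def)

sublocale P: normal P G by (rule P_normal)

lemma P_transitive:
  assumes "\<omega> \<in> \<Omega>" "\<omega>' \<in> \<Omega>"
  obtains k where "k \<in> P" "\<phi> k \<omega> = \<omega>'"
  using plinth assms transitive_on_iff[OF P.subset] unfolding plinth_def by blast

lemma P_minimal: "M \<lhd> G \<Longrightarrow> M \<subset> P \<Longrightarrow> \<not> transitive_on G \<Omega> \<phi> M"
  using plinth by (simp add: plinth_def)

lemma fixes_imp_one: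
  assumes N: "N \<lhd> G" and intrans: "\<not> transitive_on G \<Omega> \<phi> N" and g: "g \<in> N" and fix_pt: "\<phi> g \<omega> = \<omega>" "\<omega> \<in> \<Omega>"
  shows "g = \<one>"
proof -
  have "semiregular_on G \<Omega> \<phi> N" using semiprimitive N intrans by (auto simp: semiprimitive_def)
  then show ?thesis using g fix_pt unfolding semiregular_on_iff by blast
qed

section \<open>The groups \<open>K\<close>, \<open>H\<close> and \<open>L\<close> attached to a
  plinth and a point\<close>

definition point_stab where "point_stab = {g \<in> carrier G. \<phi> g \<alpha> = \<alpha>}"
definition K where "K = G\<lparr>carrier := P\<rparr>"
text \<open>The restriction to \<open>P\<close> makes these maps extensional, as members of
  \<open>auto K\<close> have to be.\<close>

definition conj where "conj g = (\<lambda>k\<in>P. inv g \<otimes> k \<otimes> g)"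
definition H where "H = conj ` point_stab"
definition L where "L = P \<inter> point_stab"

lemma K_simps [simp]: "carrier K = P" "monoid.mult K = monoid.mult G" "one K = \<one>"
  by (simp_all add: K_def)

lemma group_K: "group K"
  unfolding K_def by (rule P.subgroup_is_group[OF is_group])

sublocale K: group K by (rule group_K)

lemma inv_K [simp]: "k \<in> P \<Longrightarrow> inv\<^bsub>K\<^esub> k = inv k"
  unfolding K_def by (rule m_inv_consistent[OF P.subgroup_axioms])

lemma point_stab_subgroup: "subgroup point_stab G"
proof (rule subgroupI)
  show "point_stab \<noteq> {}" using act_one \<alpha> one_closed unfolding point_stab_def by blast
  fix g assume g: "g \<in> point_stab"
  then show "inv g \<in> point_stab" using act_inv(1)[of g \<alpha>] \<alpha> by (simp add: point_stab_def)
  fix h assume "h \<in> point_stab"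
  then show "g \<otimes> h \<in> point_stab" using g act_mult[of g h \<alpha>] \<alpha> by (simp add: point_stab_def)
qed (auto simp: point_stab_def)

sublocale point_stab: subgroup point_stab G by (rule point_stab_subgroup)

lemma act_point_stab: "g \<in> point_stab \<Longrightarrow> \<phi> g \<alpha> = \<alpha>"
  and point_stabI: "g \<in> carrier G \<Longrightarrow> \<phi> g \<alpha> = \<alpha> \<Longrightarrow> g \<in> point_stab"
  unfolding point_stab_def by blast+

lemma conj_simps [simp]: "k \<in> P \<Longrightarrow> conj g k = inv g \<otimes> k \<otimes> g"
  by (simp add: conj_def)

lemma conj_closed: "g \<in> carrier G \<Longrightarrow> k \<in> P \<Longrightarrow> inv g \<otimes> k \<otimes> g \<in> P"
  by (rule P.inv_op_closed1)

lemma conj_K: "x \<in> P \<Longrightarrow> conj_auto K x = conj x"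
  by (auto simp: conj_auto_def conj_def)

lemma conj_eqI:
  assumes "\<And>k. k \<in> P \<Longrightarrow> f k = inv g \<otimes> k \<otimes> g" "f \<in> extensional P"
  shows "f = conj g"
  by (rule extensionalityI[OF assms(2)]) (use assms(1) in \<open>simp_all add: conj_def\<close>)

lemma conj_mult:
  assumes "g \<in> carrier G" "h \<in> carrier G"
  shows "compose P (conj h) (conj g) = conj (g \<otimes> h)"
  using assms by (intro conj_eqI; simp add: compose_eq conj_closed)
    (simp add: m_assoc inv_mult_group)

lemma conj_one: "conj \<one> = (\<lambda>k\<in>P. k)"
  by (rule conj_eqI[symmetric]) simp_all

lemma conj_auto:
  assumes g: "g \<in> carrier G"
  shows "conj g \<in> auto K"
proof -
  have "bij_betw (conj g) P P"
    using g conj_closed[of g] conj_closed[of "inv g"]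
    by (intro bij_betw_byWitness[where f' = "conj (inv g)"])
      (auto simp: m_assoc mult_inv_cancel)
  moreover have "conj g \<in> hom K K"
    using g conj_closed[OF g] by (intro homI) (simp_all add: m_assoc mult_inv_cancel)
  ultimately show ?thesis by (simp add: auto_def Bij_def conj_def)
qed

text \<open>An element that fixes \<alpha> and commutes with \<open>P\<close> fixes every image of
  \<alpha> under \<open>P\<close>. As \<open>P\<close> is transitive, it fixes all points.\<close>

lemma centralizer_stab:
  assumes g: "g \<in> point_stab" and comm: "\<And>k. k \<in> P \<Longrightarrow> inv g \<otimes> k \<otimes> g = k"
  shows "g = \<one>"
proof (rule act_faithful)
  have gG: "g \<in> carrier G" using g by simp
  fix \<omega> assume "\<omega> \<in> \<Omega>"
  then obtain k where k: "k \<in> P" "\<phi> k \<alpha> = \<omega>" using P_transitive \<alpha> by blast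
  have "g \<otimes> (inv g \<otimes> k \<otimes> g) = g \<otimes> k" using comm[OF k(1)] by simp
  then have "k \<otimes> g = g \<otimes> k" using k gG by (simp add: m_assoc mult_inv_cancel)
  then have "\<phi> g (\<phi> k \<alpha>) = \<phi> k (\<phi> g \<alpha>)"
    using act_mult[OF _ gG \<alpha>, of k] act_mult[OF gG _ \<alpha>, of k] k by simp
  then show "\<phi> g \<omega> = \<omega>" using k act_point_stab[OF g] by simp
qed (use g in simp)

text \<open>If \<open>g\<close> and \<open>h\<close> induce the same automorphism, then
  \<open>g \<otimes> inv h\<close> centralises \<open>P\<close> and is trivial by
  \<open>centralizer_stab\<close>. Thus \<open>H\<close> determines the point stabiliser, which is
  what makes \<open>lift\<close> possible.\<close>

lemma conj_inj: "inj_on conj point_stab"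
proof (rule inj_onI)
  fix g h assume gh: "g \<in> point_stab" "h \<in> point_stab" "conj g = conj h"
  have "g \<otimes> inv h = \<one>"
  proof (rule centralizer_stab)
    show "g \<otimes> inv h \<in> point_stab" using gh by simp
    fix k assume k: "k \<in> P"
    have "inv g \<otimes> k \<otimes> g = inv h \<otimes> k \<otimes> h" using fun_cong[OF gh(3), of k] k by simp
    then have "h \<otimes> (inv g \<otimes> k \<otimes> g) \<otimes> inv h = k"
      using gh k by (simp add: m_assoc mult_inv_cancel)
    then show "inv (g \<otimes> inv h) \<otimes> k \<otimes> (g \<otimes> inv h) = k"
      using gh k by (simp add: m_assoc inv_mult_group)
  qed
  then have "inv (inv h) = g" using gh by (intro inv_equality) simp_all
  then show "g = h" using gh by simp
qed

lemma H_subgroup: "subgroup H (AutoGroup K)"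
proof (rule group.subgroupI[OF K.AutoGroup])
  interpret A: group "AutoGroup K" by (rule K.AutoGroup)
  show "H \<subseteq> carrier (AutoGroup K)" by (auto simp: H_def AutoGroup_simps conj_auto)
  show "H \<noteq> {}" using point_stab.one_closed unfolding H_def by blast
  \<comment> \<open>Products in \<open>AutoGroup\<close> compose from right to left, while
    \<open>conj\<close> describes a right action; hence the reversed order.\<close>
  have mult: "conj g \<otimes>\<^bsub>AutoGroup K\<^esub> conj h = conj (h \<otimes> g)" if "g \<in> point_stab" "h \<in> point_stab" for g h
    using that by (simp add: AutoGroup_simps conj_auto conj_mult)
  fix a assume "a \<in> H"
  then obtain g where g: "a = conj g" "g \<in> point_stab" by (auto simp: H_def)
  have "inv\<^bsub>AutoGroup K\<^esub> a = conj (inv g)"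
    using g mult[of "inv g" g] by (intro A.inv_equality) (simp_all add: AutoGroup_simps conj_auto conj_one)
  then show "inv\<^bsub>AutoGroup K\<^esub> a \<in> H" using g by (auto simp: H_def)
  fix b assume "b \<in> H"
  then show "a \<otimes>\<^bsub>AutoGroup K\<^esub> b \<in> H" using g mult by (auto simp: H_def)
qed

sublocale H: auto_subgroup K H
  by (intro auto_subgroup.intro auto_subgroup_axioms.intro group_K H_subgroup)

text \<open>This is the Frattini argument: the transitive subgroup \<open>P\<close> contains some
  \<open>k\<close> moving \<alpha> to the same point as \<open>g\<close>, and
  \<open>g \<otimes> inv k\<close> then fixes \<alpha>.\<close>

lemma factor:
  assumes g: "g \<in> carrier G"
  obtains s k where "s \<in> point_stab" "k \<in> P" "g = s \<otimes> k"
proof -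
  obtain k where k: "k \<in> P" "\<phi> k \<alpha> = \<phi> g \<alpha>" using P_transitive[OF \<alpha> act_closed[OF g \<alpha>]] .
  have "\<phi> (g \<otimes> inv k) \<alpha> = \<phi> (inv k) (\<phi> k \<alpha>)" using act_mult[OF g _ \<alpha>, of "inv k"] k by simp
  then have "g \<otimes> inv k \<in> point_stab" using k g act_inv(1)[of k \<alpha>] \<alpha> by (intro point_stabI) simp_all
  moreover have "g = g \<otimes> inv k \<otimes> k" using k g by (simp add: m_assoc)
  ultimately show thesis using that k by blast
qed

section \<open>Invariant normal subgroups of the plinth and faithfulness on quotients\<close>

lemma invariant_conj:
  assumes "invariant_under H R" "g \<in> point_stab" "r \<in> R" "R \<subseteq> P"
  shows "inv g \<otimes> r \<otimes> g \<in> R"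
proof -
  have "conj g r \<in> R" using assms by (auto simp: invariant_under_def H_def)
  then show ?thesis using assms by auto
qed

text \<open>Every element of \<open>G\<close> is a product of a factor in \<open>point_stab\<close>
  and one in \<open>P\<close>. The first normalises \<open>R\<close> by invariance under
  \<open>H\<close>, the second by normality in \<open>K\<close>. This brings the minimality of the
  plinth to bear on \<open>R\<close>.\<close>

lemma invariant_normal:
  assumes R: "R \<lhd> K" and inv: "invariant_under H R"
  shows "R \<lhd> G"
proof -
  interpret R: normal R K by (rule R)
  have RP: "R \<subseteq> P" using R.subset by simp
  have sub: "subgroup R G"
    using incl_subgroup[OF P.subgroup_axioms] R.subgroup_axioms by (simp add: K_def)
  have conj1: "inv g \<otimes> r \<otimes> g \<in> R" if g: "g \<in> carrier G" and r: "r \<in> R" for g r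
  proof -
    obtain s k where sk: "s \<in> point_stab" "k \<in> P" "g = s \<otimes> k" using factor[OF g] .
    have "inv s \<otimes> r \<otimes> s \<in> R" using invariant_conj[OF inv sk(1) r RP] .
    then have "inv k \<otimes> (inv s \<otimes> r \<otimes> s) \<otimes> k \<in> R" using R.inv_op_closed1[of k] sk by simp
    moreover have "r \<in> carrier G" by (rule P.mem_carrier) (use r RP in blast)
    ultimately show ?thesis using sk by (simp add: m_assoc inv_mult_group)
  qed
  show ?thesis
    unfolding normal_inv_iff
  proof (intro conjI ballI sub)
    fix g r assume "g \<in> carrier G" "r \<in> R"
    then show "g \<otimes> r \<otimes> inv g \<in> R" using conj1[of "inv g" r] by simp
  qed
qed

lemma not_transitive_of_invariant:
  assumes "R \<lhd> K" "invariant_under H R" "R \<noteq> P"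
  shows "\<not> transitive_on G \<Omega> \<phi> R"
proof (rule P_minimal)
  show "R \<lhd> G" by (rule invariant_normal[OF assms(1,2)])
  show "R \<subset> P" using assms normal_imp_subgroup[OF assms(1)] subgroup.subset by fastforce
qed

text \<open>
  An element of the point stabiliser that centralises \<open>P/R\<close> fixes every \<open>R\<close>-orbit. The kernel of
  the action on the \<open>R\<close>-orbits is an intransitive normal subgroup, hence semiregular.
\<close>

lemma centralizer_quotient_stab:
  assumes R: "R \<lhd> K" "invariant_under H R" "R \<noteq> P"
    and g: "g \<in> point_stab" and comm: "\<And>k. k \<in> P \<Longrightarrow> \<exists>r\<in>R. inv g \<otimes> k \<otimes> g = k \<otimes> r"
  shows "g = \<one>"
proof -
  have RG: "R \<lhd> G" by (rule invariant_normal[OF R(1,2)])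
  interpret R: normal R G by (rule RG)
  define orb where "orb \<omega> = (\<lambda>r. \<phi> r \<omega>) ` R" for \<omega>
  have orb_self: "\<omega> \<in> orb \<omega>" if "\<omega> \<in> \<Omega>" for \<omega>
    unfolding orb_def by (rule image_eqI[where x = \<one>]) (simp_all add: act_one that)
  have orb_trans: "\<omega>'' \<in> orb \<omega>" if \<omega>: "\<omega> \<in> \<Omega>" "\<omega>' \<in> orb \<omega>" "\<omega>'' \<in> orb \<omega>'" for \<omega> \<omega>' \<omega>''
  proof -
    obtain r s where rs: "r \<in> R" "\<omega>' = \<phi> r \<omega>" "s \<in> R" "\<omega>'' = \<phi> s \<omega>'" using \<omega> by (auto simp: orb_def)
    have "\<omega>'' = \<phi> (r \<otimes> s) \<omega>" using rs \<omega> act_mult[of r s \<omega>] by simp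
    then show ?thesis using rs unfolding orb_def by blast
  qed
  have orb_sym: "\<omega> \<in> orb \<omega>'" if \<omega>: "\<omega> \<in> \<Omega>" "\<omega>' \<in> orb \<omega>" for \<omega> \<omega>'
  proof -
    obtain r where r: "r \<in> R" "\<omega>' = \<phi> r \<omega>" using \<omega> by (auto simp: orb_def)
    then have "\<omega> = \<phi> (inv r) \<omega>'" using act_inv(1)[of r \<omega>] \<omega> by simp
    then show ?thesis using r unfolding orb_def by blast
  qed
  have orb_act: "\<phi> a \<omega>' \<in> orb (\<phi> a \<omega>)" if a: "a \<in> carrier G" and \<omega>: "\<omega> \<in> \<Omega>" and \<omega>': "\<omega>' \<in> orb \<omega>" for a \<omega> \<omega>'
  proof -
    obtain r where r: "r \<in> R" "\<omega>' = \<phi> r \<omega>" using \<omega>' by (auto simp: orb_def)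
    have rG: "r \<in> carrier G" using r by simp
    have "\<phi> a \<omega>' = \<phi> (r \<otimes> a) \<omega>" using r rG a \<omega> act_mult by simp
    also have "r \<otimes> a = a \<otimes> (inv a \<otimes> r \<otimes> a)" using rG a by (simp add: m_assoc mult_inv_cancel)
    also have "\<phi> \<dots> \<omega> = \<phi> (inv a \<otimes> r \<otimes> a) (\<phi> a \<omega>)" using rG a \<omega> by (intro act_mult) simp_all
    finally show ?thesis using R.inv_op_closed1[OF a r(1)] unfolding orb_def by blast
  qed
  \<comment> \<open>This is the kernel of the action of \<open>G\<close> on the
    \<open>R\<close>-orbits; its normality comes from \<open>orb_act\<close>, that is, from
    \<open>G\<close> permuting these orbits.\<close>
  define M where "M = {a \<in> carrier G. \<forall>\<omega>\<in>\<Omega>. \<phi> a \<omega> \<in> orb \<omega>}"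
  have M_sub: "subgroup M G"
  proof (rule subgroupI)
    have "\<one> \<in> M" using act_one orb_self by (simp add: M_def)
    then show "M \<noteq> {}" by blast
    fix a assume a: "a \<in> M"
    then have aG: "a \<in> carrier G" by (simp add: M_def)
    show "inv a \<in> M"
      unfolding M_def
    proof (intro CollectI conjI ballI)
      fix \<omega> assume \<omega>: "\<omega> \<in> \<Omega>"
      let ?\<omega> = "\<phi> (inv a) \<omega>"
      have w: "?\<omega> \<in> \<Omega>" using \<omega> aG act_closed by simp
      have "\<phi> a ?\<omega> \<in> orb ?\<omega>" using a w by (simp add: M_def)
      then have "\<omega> \<in> orb ?\<omega>" using act_inv(2)[OF aG \<omega>] by simp
      then show "?\<omega> \<in> orb \<omega>" using orb_sym[OF w] by blast
    qed (use aG in simp)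
    fix b assume b: "b \<in> M"
    then have bG: "b \<in> carrier G" by (simp add: M_def)
    show "a \<otimes> b \<in> M"
      unfolding M_def
    proof (intro CollectI conjI ballI)
      fix \<omega> assume \<omega>: "\<omega> \<in> \<Omega>"
      have "\<phi> a \<omega> \<in> orb \<omega>" "\<phi> b (\<phi> a \<omega>) \<in> orb (\<phi> a \<omega>)"
        using a b \<omega> act_closed[OF aG \<omega>] by (simp_all add: M_def)
      then show "\<phi> (a \<otimes> b) \<omega> \<in> orb \<omega>"
        using orb_trans[OF \<omega>] act_mult[OF aG bG \<omega>] by simp
    qed (use aG bG in simp)
  qed (auto simp: M_def)
  have M: "M \<lhd> G"
    unfolding normal_inv_iff
  proof (intro conjI ballI M_sub)
    fix x a assume x: "x \<in> carrier G" and a: "a \<in> M"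
    then have aG: "a \<in> carrier G" by (simp add: M_def)
    have "\<phi> (x \<otimes> a \<otimes> inv x) \<omega> \<in> orb \<omega>" if \<omega>: "\<omega> \<in> \<Omega>" for \<omega>
    proof -
      have x\<omega>: "\<phi> x \<omega> \<in> \<Omega>" using act_closed[OF x \<omega>] .
      then have "\<phi> a (\<phi> x \<omega>) \<in> orb (\<phi> x \<omega>)" using a by (simp add: M_def)
      then have "\<phi> (inv x) (\<phi> a (\<phi> x \<omega>)) \<in> orb (\<phi> (inv x) (\<phi> x \<omega>))"
        using orb_act[OF inv_closed[OF x] x\<omega>] by blast
      then show ?thesis using x aG \<omega> by (simp add: act_mult act_inv)
    qed
    then show "x \<otimes> a \<otimes> inv x \<in> M" using x aG by (simp add: M_def)
  qed
  have R_intrans: "\<not> transitive_on G \<Omega> \<phi> R" by (rule not_transitive_of_invariant[OF R])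
  \<comment> \<open>As \<open>M\<close> moves each point within its \<open>R\<close>-orbit, a
    transitive \<open>M\<close> would force \<open>R\<close> to be transitive.\<close>
  have M_intrans: "\<not> transitive_on G \<Omega> \<phi> M"
  proof
    assume "transitive_on G \<Omega> \<phi> M"
    then have tr: "\<forall>\<omega>\<in>\<Omega>. \<forall>\<omega>'\<in>\<Omega>. \<exists>a\<in>M. \<phi> a \<omega> = \<omega>'"
      using transitive_on_iff[OF subgroup.subset[OF M_sub]] by simp
    have "\<exists>r\<in>R. \<phi> r \<omega> = \<omega>'" if \<omega>: "\<omega> \<in> \<Omega>" "\<omega>' \<in> \<Omega>" for \<omega> \<omega>'
    proof -
      obtain a where "a \<in> M" "\<phi> a \<omega> = \<omega>'" using tr \<omega> by blast
      then have "\<omega>' \<in> orb \<omega>" using \<omega> by (auto simp: M_def)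
      then show ?thesis unfolding orb_def by blast
    qed
    then have "transitive_on G \<Omega> \<phi> R" using transitive_on_iff[OF R.subset] \<alpha> by blast
    then show False using R_intrans by blast
  qed
  have gG: "g \<in> carrier G" using g by simp
  have "g \<in> M"
    unfolding M_def
  proof (intro CollectI conjI ballI gG)
    fix \<omega> assume "\<omega> \<in> \<Omega>"
    then obtain k where k: "k \<in> P" "\<phi> k \<alpha> = \<omega>" using P_transitive \<alpha> by blast
    obtain r where r: "r \<in> R" "inv g \<otimes> k \<otimes> g = k \<otimes> r" using comm[OF k(1)] by blast
    have kr: "k \<in> carrier G" "r \<in> carrier G" using k r by simp_all
    \<comment> \<open>Acting on \<alpha>, the product \<open>k \<otimes> g\<close> equals
      \<open>g \<otimes> k \<otimes> r\<close>. As \<open>g\<close> fixes \<alpha>, the image of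
      \<omega> under \<open>g\<close> is its image under \<open>r\<close>.\<close>
    have "k \<otimes> g = g \<otimes> (inv g \<otimes> k \<otimes> g)" using kr gG by (simp add: m_assoc mult_inv_cancel)
    also have "\<dots> = g \<otimes> (k \<otimes> r)" using r by simp
    finally have "\<phi> (k \<otimes> g) \<alpha> = \<phi> (g \<otimes> (k \<otimes> r)) \<alpha>" by simp
    then have "\<phi> g \<omega> = \<phi> r \<omega>"
      using kr gG \<alpha> act_point_stab[OF g] k by (simp add: act_mult)
    then show "\<phi> g \<omega> \<in> orb \<omega>" using r unfolding orb_def by blast
  qed
  then show ?thesis using fixes_imp_one[OF M M_intrans _ act_point_stab[OF g] \<alpha>] by blast
qed

lemma faithful_quotient:
  assumes R: "R \<lhd> K" "invariant_under H R" "R \<noteq> P"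
  shows "faithful_on_quotient K H R"
  unfolding faithful_on_quotient_def
proof (rule faithful_actionI)
  interpret R: normal R K by (rule R(1))
  have RP: "R \<subseteq> carrier K" by (rule R.subset)
  have img: "h ` (R #>\<^bsub>K\<^esub> k) = R #>\<^bsub>K\<^esub> h k" if "h \<in> H" "k \<in> P" for h k
    using H.image_rcoset[OF R(2) RP that(1)] that by simp
  have quot: "\<exists>k\<in>P. C = R #>\<^bsub>K\<^esub> k" if "C \<in> carrier (K Mod R)" for C
    using that by (auto simp: carrier_FactGroup)
  have quotI: "R #>\<^bsub>K\<^esub> k \<in> carrier (K Mod R)" if "k \<in> P" for k
    using that by (auto simp: carrier_FactGroup)
  show "group (AutoGroup K\<lparr>carrier := H\<rparr>)"
    by (rule subgroup.subgroup_is_group[OF H_subgroup K.AutoGroup])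
  fix h assume "h \<in> carrier (AutoGroup K\<lparr>carrier := H\<rparr>)"
  then have h: "h \<in> H" by simp
  show "(\<lambda>C\<in>carrier (K Mod R). h ` C) \<in> extensional (carrier (K Mod R))" by simp
  show "(\<lambda>C\<in>carrier (K Mod R). h ` C) C \<in> carrier (K Mod R)" if C: "C \<in> carrier (K Mod R)" for C
  proof -
    obtain k where k: "k \<in> P" "C = R #>\<^bsub>K\<^esub> k" using quot[OF C] by blast
    then show ?thesis using C img[OF h k(1)] quotI[of "h k"] H.H_closed[OF h] by simp
  qed
  then have closed: "h ` C \<in> carrier (K Mod R)" if "C \<in> carrier (K Mod R)" for C using that by simp
  {
    fix h' C assume "h' \<in> carrier (AutoGroup K\<lparr>carrier := H\<rparr>)" and C: "C \<in> carrier (K Mod R)"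
    then have h': "h' \<in> H" by simp
    obtain k where k: "k \<in> P" "C = R #>\<^bsub>K\<^esub> k" using quot[OF C] by blast
    have h'C: "h' ` C = R #>\<^bsub>K\<^esub> h' k" using img[OF h' k(1)] k by simp
    then have h'C': "h' ` C \<in> carrier (K Mod R)" using quotI H.H_closed[OF h'] k by simp
    have "compose P h h' ` C = R #>\<^bsub>K\<^esub> compose P h h' k"
      using img[of "compose P h h'" k] H.compose_in_H[OF h h'] k by simp
    also have "\<dots> = h ` h' ` C"
      using img[OF h, of "h' k"] H.H_closed[OF h'] k h'C by (simp add: compose_eq)
    finally show "(\<lambda>C\<in>carrier (K Mod R). (h \<otimes>\<^bsub>AutoGroup K\<lparr>carrier := H\<rparr>\<^esub> h') ` C) C =
        (\<lambda>C\<in>carrier (K Mod R). h ` C) ((\<lambda>C\<in>carrier (K Mod R). h' ` C) C)"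
      using C h'C' H.H_auto[OF h] H.H_auto[OF h'] by (simp add: AutoGroup_simps)
  }
  assume triv: "\<And>C. C \<in> carrier (K Mod R) \<Longrightarrow> (\<lambda>C\<in>carrier (K Mod R). h ` C) C = C"
  obtain g where g: "h = conj g" "g \<in> point_stab" using h by (auto simp: H_def)
  have "g = \<one>"
  proof (rule centralizer_quotient_stab[OF R g(2)])
    fix k assume k: "k \<in> P"
    have gk: "inv g \<otimes> k \<otimes> g \<in> P" using conj_closed k g by simp
    have "R #>\<^bsub>K\<^esub> (inv g \<otimes> k \<otimes> g) = R #>\<^bsub>K\<^esub> k"
      using triv[OF quotI[OF k]] quotI[OF k] img[OF h k] g k by simp
    \<comment> \<open>Normality turns the fixed right coset into a left one, the form required by
      \<open>centralizer_quotient_stab\<close>.\<close>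
    moreover have "R #>\<^bsub>K\<^esub> k = k <#\<^bsub>K\<^esub> R" using R.coset_eq k by simp
    ultimately have "inv g \<otimes> k \<otimes> g \<in> k <#\<^bsub>K\<^esub> R"
      using K.rcos_self[of "inv g \<otimes> k \<otimes> g" R] gk R.subgroup_axioms by simp
    then show "\<exists>r\<in>R. inv g \<otimes> k \<otimes> g = k \<otimes> r" by (auto simp: l_coset_def)
  qed
  then show "h = \<one>\<^bsub>AutoGroup K\<lparr>carrier := H\<rparr>\<^esub>" using g by (simp add: AutoGroup_simps conj_one)
next
  fix C assume C: "C \<in> carrier (K Mod R)"
  interpret R: normal R K by (rule R(1))
  have "C \<subseteq> P" using C K.r_coset_subset_G[OF R.subset] by (auto simp: carrier_FactGroup)
  then have "(\<lambda>k\<in>P. k) ` C = C" by force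
  then show "(\<lambda>C\<in>carrier (K Mod R). \<one>\<^bsub>AutoGroup K\<lparr>carrier := H\<rparr>\<^esub> ` C) C = C"
    using C by (simp add: AutoGroup_simps)
qed

section \<open>The conditions on \<open>L\<close>\<close>

lemma L_subgroup: "subgroup L K"
  unfolding L_def K_def
  using subgroup_incl[OF subgroups_Inter_pair[OF P.subgroup_axioms point_stab.subgroup_axioms] P.subgroup_axioms] by simp

lemma conj_L:
  assumes "g \<in> point_stab" "u \<in> L"
  shows "inv g \<otimes> u \<otimes> g \<in> L"
  using assms conj_closed[of g u] by (simp add: L_def)

lemma L_invariant: "invariant_under H L"
  unfolding invariant_under_def
proof (intro ballI equalityI subsetI)
  fix h u assume h: "h \<in> H"
  obtain g where g: "h = conj g" "g \<in> point_stab" using h by (auto simp: H_def)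
  {
    assume "u \<in> h ` L"
    then show "u \<in> L" using g conj_L by (auto simp: L_def)
  }
  assume u: "u \<in> L"
  have "inv (inv g) \<otimes> u \<otimes> inv g \<in> L" using conj_L[of "inv g"] g u by simp
  moreover have "h (inv (inv g) \<otimes> u \<otimes> inv g) = u"
    using g u calculation by (simp add: L_def m_assoc mult_inv_cancel)
  ultimately show "u \<in> h ` L" by force
qed

text \<open>An element \<open>x\<close> of \<open>conj_preimage K H\<close> may itself move
  \<alpha>, but on \<open>P\<close> it acts by conjugation like some \<open>g\<close> in the point
  stabiliser, and such a \<open>g\<close> normalises \<open>L\<close>.\<close>

lemma L_normal: "L \<lhd> K\<lparr>carrier := conj_preimage K H\<rparr>"
proof -
  have sub: "subgroup (conj_preimage K H) K" by (rule H.subgroup_conj_preimage)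
  interpret C: group "K\<lparr>carrier := conj_preimage K H\<rparr>"
    by (rule subgroup.subgroup_is_group[OF sub group_K])
  have LC: "L \<subseteq> conj_preimage K H"
    by (auto simp: conj_preimage_def L_def H_def conj_K)
  have conj: "inv x \<otimes> u \<otimes> x \<in> L" if x: "x \<in> conj_preimage K H" and u: "u \<in> L" for x u
  proof -
    have xP: "x \<in> P" and "conj x \<in> H" using x by (auto simp: conj_preimage_def conj_K)
    then obtain g where g: "conj x = conj g" "g \<in> point_stab" by (auto simp: H_def)
    have "inv x \<otimes> u \<otimes> x = inv g \<otimes> u \<otimes> g" using fun_cong[OF g(1), of u] u by (simp add: L_def)
    then show ?thesis using conj_L g u by simp
  qed
  show ?thesis
    unfolding C.normal_inv_iff
  proof (intro conjI ballI)
    show "subgroup L (K\<lparr>carrier := conj_preimage K H\<rparr>)"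
      using K.subgroup_incl[OF L_subgroup sub LC] .
    fix x u assume x: "x \<in> carrier (K\<lparr>carrier := conj_preimage K H\<rparr>)" and u: "u \<in> L"
    have x': "x \<in> conj_preimage K H" and xP: "x \<in> P" using x by (auto simp: conj_preimage_def)
    have ix: "inv\<^bsub>K\<^esub> x \<in> conj_preimage K H" using subgroup.m_inv_closed[OF sub x'] .
    have "inv\<^bsub>K\<lparr>carrier := conj_preimage K H\<rparr>\<^esub> x = inv x"
      using K.m_inv_consistent[OF sub x'] xP by simp
    then show "x \<otimes>\<^bsub>K\<lparr>carrier := conj_preimage K H\<rparr>\<^esub> u \<otimes>\<^bsub>K\<lparr>carrier := conj_preimage K H\<rparr>\<^esub>
        inv\<^bsub>K\<lparr>carrier := conj_preimage K H\<rparr>\<^esub> x \<in> L"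
      using conj[OF ix u] xP by simp
  qed
qed

text \<open>An element of the conjugate of \<open>L\<close> by \<open>k\<close> fixes the image of
  \<alpha> under \<open>k\<close>. Lying in all these conjugates therefore means fixing every point,
  since \<open>P\<close> is transitive.\<close>

lemma L_core_free: "core_free K L"
  unfolding core_free_def
proof (intro equalityI subsetI)
  fix m assume m: "m \<in> (\<Inter>k\<in>carrier K. inv\<^bsub>K\<^esub> k <#\<^bsub>K\<^esub> L #>\<^bsub>K\<^esub> k)"
  have conj: "\<exists>u\<in>L. m = inv k \<otimes> u \<otimes> k" if k: "k \<in> P" for k
  proof -
    have "m \<in> inv\<^bsub>K\<^esub> k <#\<^bsub>K\<^esub> L #>\<^bsub>K\<^esub> k" using m k by auto
    then show ?thesis using k by (auto simp: l_coset_def r_coset_def)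
  qed
  obtain u where "u \<in> L" "m = inv \<one> \<otimes> u \<otimes> \<one>" using conj[OF P.one_closed] by blast
  then have mG: "m \<in> carrier G" by (simp add: L_def)
  have "m = \<one>"
  proof (rule act_faithful[OF mG])
    fix \<omega> assume "\<omega> \<in> \<Omega>"
    then obtain k where k: "k \<in> P" "\<phi> k \<alpha> = \<omega>" using P_transitive \<alpha> by blast
    obtain u where u: "u \<in> L" "m = inv k \<otimes> u \<otimes> k" using conj[OF k(1)] by blast
    have kG: "k \<in> carrier G" and uG: "u \<in> carrier G" and uS: "u \<in> point_stab" using k u by (auto simp: L_def)
    have "k \<otimes> m = u \<otimes> k" using u kG uG by (simp add: m_assoc mult_inv_cancel)
    then have "\<phi> m (\<phi> k \<alpha>) = \<phi> k (\<phi> u \<alpha>)"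
      using act_mult[OF kG mG \<alpha>] act_mult[OF uG kG \<alpha>] by simp
    then show "\<phi> m \<omega> = \<omega>" using k act_point_stab[OF uS] by simp
  qed
  then show "m \<in> {\<one>\<^bsub>K\<^esub>}" by simp
next
  fix m assume m: "m \<in> {\<one>\<^bsub>K\<^esub>}"
  have "\<one> \<in> inv\<^bsub>K\<^esub> k <#\<^bsub>K\<^esub> L #>\<^bsub>K\<^esub> k" if k: "k \<in> P" for k
  proof -
    have "\<one> = inv k \<otimes> \<one> \<otimes> k" using k by simp
    moreover have "\<one> \<in> L" by (simp add: L_def)
    ultimately show ?thesis using k unfolding l_coset_def r_coset_def by fastforce
  qed
  then show "m \<in> (\<Inter>k\<in>carrier K. inv\<^bsub>K\<^esub> k <#\<^bsub>K\<^esub> L #>\<^bsub>K\<^esub> k)" using m by simp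
qed

text \<open>Elements of \<open>L\<close> lie in \<open>P\<close>, so they act trivially on the
  abelian quotient of \<open>P\<close> by its derived subgroup. If that subgroup were proper,
  \<open>centralizer_quotient_stab\<close> would make \<open>L\<close> trivial.\<close>

lemma K_perfect:
  assumes "L \<noteq> {\<one>}"
  shows "P = derived K P"
proof (rule ccontr)
  assume ne: "P \<noteq> derived K P"
  have R: "derived K P \<lhd> K" using K.derived_self_is_normal by simp
  \<comment> \<open>Viewed in \<open>G\<close>, the derived subgroup of the normal subgroup
    \<open>P\<close> is normal, which yields invariance under \<open>H\<close>.\<close>
  have dG: "derived K P = derived G P"
    unfolding K_def by (rule derived_consistent[OF subset_refl P.subgroup_axioms])
  interpret D: normal "derived G P" G by (rule derived_is_normal[OF P_normal])
  have DP: "derived G P \<subseteq> P" by (rule derived_incl[OF subset_refl P.subgroup_axioms])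
  have inv: "invariant_under H (derived K P)"
    unfolding invariant_under_def dG
  proof (intro ballI equalityI subsetI)
    fix h r assume h: "h \<in> H"
    obtain g where g: "h = conj g" "g \<in> point_stab" using h by (auto simp: H_def)
    have gG: "g \<in> carrier G" using g by simp
    {
      assume "r \<in> h ` derived G P"
      then show "r \<in> derived G P" using g DP D.inv_op_closed1[OF gG] by auto
    }
    assume r: "r \<in> derived G P"
    then have rP: "r \<in> P" "r \<in> carrier G" using DP by auto
    have "g \<otimes> r \<otimes> inv g \<in> derived G P" using D.inv_op_closed2[OF gG r] .
    moreover have "h (g \<otimes> r \<otimes> inv g) = r"
      using g gG rP calculation DP by (simp add: subset_iff m_assoc mult_inv_cancel)
    ultimately show "r \<in> h ` derived G P" by force
  qed
  have "u = \<one>" if u: "u \<in> L" for u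
  proof (rule centralizer_quotient_stab[OF R inv])
    show "derived K P \<noteq> P" using ne by simp
    show "u \<in> point_stab" using u by (simp add: L_def)
    fix k assume k: "k \<in> P"
    have uP: "u \<in> P" using u by (simp add: L_def)
    \<comment> \<open>This is the commutator of \<open>inv k\<close> and \<open>inv u\<close>,
      written in the form of the generators in \<open>derived_def\<close>.\<close>
    have "inv k \<otimes> inv u \<otimes> inv (inv k) \<otimes> inv (inv u) \<in> derived G P"
      unfolding derived_def using k uP P.m_inv_closed by (intro generate.incl) blast
    then have "inv k \<otimes> (inv u \<otimes> k \<otimes> u) \<in> derived G P" using k uP by (simp add: m_assoc)
    moreover have "inv u \<otimes> k \<otimes> u = k \<otimes> (inv k \<otimes> (inv u \<otimes> k \<otimes> u))"
      using k uP by (simp add: mult_inv_cancel)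
    ultimately show "\<exists>r\<in>derived K P. inv u \<otimes> k \<otimes> u = k \<otimes> r" unfolding dG by blast
  qed
  moreover have "\<one> \<in> L" by (simp add: L_def)
  ultimately show False using assms by blast
qed

text \<open>Since \<open>L\<close> fixes \<alpha>, the equation \<open>P = LR\<close> would give
  \<open>R\<close> the same orbit of \<alpha> as \<open>P\<close>. Then \<open>R\<close> would be
  transitive, contradicting the minimality of the plinth.\<close>

lemma L_not_supplement:
  assumes R: "R \<lhd> K" "invariant_under H R" "R \<noteq> P"
  shows "P \<noteq> L <#>\<^bsub>K\<^esub> R"
proof
  assume PLR: "P = L <#>\<^bsub>K\<^esub> R"
  interpret R: normal R G by (rule invariant_normal[OF R(1,2)])
  have base: "\<exists>r\<in>R. \<phi> r \<alpha> = \<omega>" if "\<omega> \<in> \<Omega>" for \<omega>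
  proof -
    obtain k where k: "k \<in> P" "\<phi> k \<alpha> = \<omega>" using P_transitive \<alpha> \<open>\<omega> \<in> \<Omega>\<close> by blast
    have "k \<in> L <#>\<^bsub>K\<^esub> R" using k PLR by simp
    then obtain u r where ur: "u \<in> L" "r \<in> R" "k = u \<otimes> r" by (auto simp: set_mult_def)
    have uS: "u \<in> point_stab" using ur by (simp add: L_def)
    have "\<phi> k \<alpha> = \<phi> r \<alpha>" using ur uS act_mult[of u r \<alpha>] \<alpha> act_point_stab[OF uS] by simp
    then show ?thesis using k ur by auto
  qed
  have "\<exists>r\<in>R. \<phi> r \<omega> = \<omega>'" if \<omega>: "\<omega> \<in> \<Omega>" "\<omega>' \<in> \<Omega>" for \<omega> \<omega>'
  proof -
    obtain r s where rs: "r \<in> R" "\<phi> r \<alpha> = \<omega>" "s \<in> R" "\<phi> s \<alpha> = \<omega>'" using base \<omega> by blast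
    have "\<phi> (inv r \<otimes> s) \<omega> = \<omega>'" using rs act_mult[of "inv r" s \<omega>] act_inv(1)[of r \<alpha>] \<alpha> \<omega> by auto
    then show ?thesis using rs by blast
  qed
  then have "transitive_on G \<Omega> \<phi> R" using transitive_on_iff[OF R.subset] \<alpha> by blast
  then show False using not_transitive_of_invariant[OF R] by blast
qed

lemma semiprimitive_triple: "semiprimitive_triple K H L"
  unfolding semiprimitive_triple_def
  using group_K H_subgroup faithful_quotient L_normal L_core_free L_invariant K_perfect L_not_supplement
  by simp

sublocale T: triple K H L
  by (intro triple.intro triple_axioms.intro H.auto_subgroup_axioms semiprimitive_triple)

section \<open>The multiplication epimorphism from the semidirect product onto
  \<open>G\<close>\<close>

definition lift where "lift h = inv_into point_stab conj h"

lemma lift_conj: "g \<in> point_stab \<Longrightarrow> lift (conj g) = g"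
  unfolding lift_def by (rule inv_into_f_f[OF conj_inj])

lemma HE:
  assumes "h \<in> H"
  obtains g where "g \<in> point_stab" "h = conj g" "lift h = g"
  using assms lift_conj by (auto simp: H_def)

lemma conj_in_H: "g \<in> point_stab \<Longrightarrow> conj g \<in> H"
  by (simp add: H_def)

definition mult_map where "mult_map = (\<lambda>(h, k). lift h \<otimes> k)"

text \<open>Moving \<open>g'\<close> to the left past \<open>k\<close> gives \<open>g \<otimes> k
  \<otimes> g' \<otimes> k' = (g \<otimes> g') \<otimes> (inv g' \<otimes> k \<otimes> g') \<otimes>
  k'\<close>, which is the multiplication rule of the semidirect product.\<close>

lemma mult_map_hom: "group_hom (semidirect K H) G mult_map"
proof -
  have "mult_map \<in> hom (semidirect K H) G"
  proof (rule homI)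
    fix x assume "x \<in> carrier (semidirect K H)"
    then obtain h k where x: "x = (h, k)" "h \<in> H" "k \<in> P" by auto
    obtain g where g: "g \<in> point_stab" "h = conj g" "lift h = g" using HE[OF x(2)] .
    then show "mult_map x \<in> carrier G" using x by (simp add: mult_map_def)
    fix y assume "y \<in> carrier (semidirect K H)"
    then obtain h' k' where y: "y = (h', k')" "h' \<in> H" "k' \<in> P" by auto
    obtain g' where g': "g' \<in> point_stab" "h' = conj g'" "lift h' = g'" using HE[OF y(2)] .
    have "lift (compose P h' h) = g \<otimes> g'" using g g' by (simp add: conj_mult lift_conj)
    then show "mult_map (x \<otimes>\<^bsub>semidirect K H\<^esub> y) = mult_map x \<otimes> mult_map y"
      using x y g g' by (simp add: H.mult_semidirect mult_map_def m_assoc mult_inv_cancel)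
  qed
  then show ?thesis
    by (simp add: group_hom_def group_hom_axioms_def H.group_semidirect is_group)
qed

lemma mult_map_surj: "mult_map ` carrier (semidirect K H) = carrier G"
proof
  show "mult_map ` carrier (semidirect K H) \<subseteq> carrier G"
    using group_hom.hom_closed[OF mult_map_hom] by blast
  show "carrier G \<subseteq> mult_map ` carrier (semidirect K H)"
  proof
    fix g assume "g \<in> carrier G"
    then obtain s k where sk: "s \<in> point_stab" "k \<in> P" "g = s \<otimes> k" by (rule factor)
    then have "g = mult_map (conj s, k)" "(conj s, k) \<in> carrier (semidirect K H)"
      by (simp_all add: mult_map_def lift_conj conj_in_H)
    then show "g \<in> mult_map ` carrier (semidirect K H)" by blast
  qed
qed

text \<open>If \<open>g \<otimes> k = \<one>\<close> with \<open>g\<close> in the stabiliser and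
  \<open>k \<in> P\<close>, then \<open>k = inv g\<close> lies in both, hence in \<open>L\<close>,
  and the automorphism is conjugation by \<open>inv k\<close>.\<close>

lemma mult_map_kernel: "kernel (semidirect K H) G mult_map = triple_kernel K L"
proof (intro equalityI subsetI)
  fix x assume x: "x \<in> kernel (semidirect K H) G mult_map"
  then obtain h k where hk: "x = (h, k)" "h \<in> H" "k \<in> P" "lift h \<otimes> k = \<one>"
    by (auto simp: kernel_def mult_map_def)
  obtain g where g: "g \<in> point_stab" "h = conj g" "lift h = g" using HE[OF hk(2)] .
  have gk: "inv k = g" using hk g by (intro inv_equality) simp_all
  then have "k = inv g" using hk by auto
  then have "k \<in> L" using g hk by (simp add: L_def)
  moreover have "h = conj_auto K (inv\<^bsub>K\<^esub> k)" using g(2) gk hk(3) conj_K[OF P.m_inv_closed[OF hk(3)]] by simp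
  ultimately show "x \<in> triple_kernel K L" using hk T.kernel_mem_iff by simp
next
  fix x assume "x \<in> triple_kernel K L"
  then obtain u where u: "x = (conj_auto K (inv\<^bsub>K\<^esub> u), u)" "u \<in> L" by (auto simp: triple_kernel_def)
  then have uP: "u \<in> P" and uS: "inv u \<in> point_stab" by (auto simp: L_def)
  have "x = (conj (inv u), u)" using u uP conj_K[of "inv u"] by simp
  then show "x \<in> kernel (semidirect K H) G mult_map"
    using uP uS by (simp add: kernel_def mult_map_def lift_conj conj_in_H)
qed

text \<open>The factor \<open>lift h\<close> fixes \<alpha>, so whether the product fixes \<alpha>
  depends on \<open>k\<close> alone.\<close>

lemma mult_map_stabilizer:
  "{x \<in> carrier (semidirect K H). \<phi> (mult_map x) \<alpha> = \<alpha>} = triple_stabilizer K H L"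
proof -
  have "\<phi> (lift h \<otimes> k) \<alpha> = \<alpha> \<longleftrightarrow> k \<in> L" if hk: "h \<in> H" "k \<in> P" for h k
  proof -
    obtain g where g: "g \<in> point_stab" "h = conj g" "lift h = g" using HE[OF hk(1)] .
    have "\<phi> (lift h \<otimes> k) \<alpha> = \<phi> k \<alpha>"
      using g hk act_mult[of g k \<alpha>] \<alpha> act_point_stab[OF g(1)] by simp
    then show ?thesis
      using hk act_point_stab[of k] point_stabI[of k] unfolding L_def by auto
  qed
  moreover have "L \<subseteq> P" by (auto simp: L_def)
  ultimately show ?thesis by (auto simp: T.triple_stabilizer_eq mult_map_def)
qed

lemma permutationally_isomorphic_triple:
  "permutationally_isomorphic G \<Omega> \<phi> (triple_group K H L) (triple_points K H L) (triple_action K H L)"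
proof -
  have "transitive_on G \<Omega> \<phi> (carrier G)" using semiprimitive by (simp add: semiprimitive_def)
  from permutationally_isomorphic_coset_action[OF mult_map_hom mult_map_surj \<alpha> this]
  show ?thesis
    unfolding mult_map_kernel mult_map_stabilizer
    by (simp add: triple_group_def triple_points_def T.triple_action_eq)
qed

end

section \<open>The two directions of the correspondence\<close>

theorem theorem1p3:
  shows "(\<forall>(G :: 'g monoid) (\<Omega> :: 'a set) \<phi>.
            semiprimitive G \<Omega> \<phi> \<and> (\<exists>P. plinth G \<Omega> \<phi> P) \<longrightarrow>
            (\<exists>(K :: 'g monoid) H L. semiprimitive_triple K H L \<and>
               permutationally_isomorphic G \<Omega> \<phi>
                 (triple_group K H L) (triple_points K H L) (triple_action K H L)))
       \<and> (\<forall>(K :: 'k monoid) H L. semiprimitive_triple K H L \<longrightarrow>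
            semiprimitive (triple_group K H L) (triple_points K H L) (triple_action K H L))"
proof (intro conjI allI impI)
  fix G :: "'g monoid" and \<Omega> :: "'a set" and \<phi>
  assume G: "semiprimitive G \<Omega> \<phi> \<and> (\<exists>P. plinth G \<Omega> \<phi> P)"
  then obtain P where P: "plinth G \<Omega> \<phi> P" by blast
  have "permutation_group G \<Omega> \<phi>" using G by (simp add: semiprimitive_def)
  then interpret perm_group G \<Omega> \<phi>
    by (simp add: perm_group_def perm_group_axioms_def permutation_group_def)
  \<comment> \<open>Transitivity supplies a point at which the triple can be formed.\<close>
  have "\<Omega> \<noteq> {}" using G transitive_on_iff[OF subset_refl] by (simp add: semiprimitive_def)
  then obtain \<alpha> where "\<alpha> \<in> \<Omega>" by blast
  then interpret pointed_plinth G \<Omega> \<phi> P \<alpha>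
    using G P by unfold_locales auto
  show "\<exists>(K :: 'g monoid) H L. semiprimitive_triple K H L \<and>
    permutationally_isomorphic G \<Omega> \<phi> (triple_group K H L) (triple_points K H L) (triple_action K H L)"
    using semiprimitive_triple permutationally_isomorphic_triple by blast
next
  fix K :: "'k monoid" and H L
  assume T: "semiprimitive_triple K H L"
  then interpret triple K H L
    by (simp add: triple_def triple_axioms_def auto_subgroup_def auto_subgroup_axioms_def semiprimitive_triple_def)
  show "semiprimitive (triple_group K H L) (triple_points K H L) (triple_action K H L)"
    by (rule semiprimitive)
qed

end
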